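(* Let $\Omega$, the operators $\nabla$ and $\Delta$, the functions $a$ and $g$, the numbers $r,k,p$, and the quantities $E$, $E_1$, $X(u_0,u_1)$ be as in the context. Let $\mathcal{G}:[0,+\infty)\to[0,+\infty)$ be a continuous strictly increasing bijection and let $\mathcal{F}(x)=x\,(\mathcal{G}(x))^2$. Assume that $x\mapsto x\,\mathcal{F}^{-1}\!\left(\frac1x\right)$ is an increasing function on $(0,+\infty)$ and that there exists $C_1>0$ such that for all non-identically zero $(u_0,u_1)\in[H^2(\Omega)\cap H^1_0(\Omega)]\times H^1_0(\Omega)$, the solution $\phi$ of $\partial_t^2\phi-\Delta\phi=0$ in $\Omega\times(0,+\infty)$, $\phi=0$ on $\partial\Omega\times(0,+\infty)$, $(\phi,\partial_t\phi)(\cdot,0)=(u_0,u_1)$, satisfies $$\|(u_0,u_1)\|^2_{H^1_0(\Omega)\times L^2(\Omega)}\le C_1\int_0^{1/\mathcal{G}\left(\frac{1}{2C_1\Lambda_r}\right)}\int_\Omega a(x)|\partial_t\phi(x,t)|^2\,dx\,dt,\qquad \Lambda_r=\frac{(r-1)+X(u_0,u_1)}{E(u(0))}.$$ Let $c>0$ and the function $G(h)=C_2\,h^{2r+1}\,\mathcal{F}(h)^{4(r+1)}$, with $C_2>0$ a constant, be such that for every $(u_0,u_1)\in[H^2(\Omega)\cap H^1_0(\Omega)]\times H^1_0(\Omega)$, every $h>0$ and every $s\ge0$, the solution $u$ of the nonlinear damped wave equation $$\partial_t^2u-\Delta u+a(x)g(\partial_tu)=0\ \text{in }\Omega\times(0,+\infty),\quad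 u=0\ \text{on }\partial\Omega\times(0,+\infty),\quad (u,\partial_tu)(\cdot,0)=(u_0,u_1)\ \text{in }\Omega,$$ satisfies $$E(u(s))\le c\,h\,\big((r-1)+X(u_0,u_1)\big)+c\int_s^{s+\frac{1}{G(h)}}\int_\Omega a(x)\,g(\partial_tu(x,t))\,\partial_tu(x,t)\,dx\,dt .$$ Suppose that there exists $c_0>0$ such that $G^{-1}(x)\ge\frac{c}{c+1}\,G^{-1}\big(x(c_0+1)\big)$ for all $x\ge0$. Then for all non-identically zero initial data $(u_0,u_1)\in[H^2(\Omega)\cap H^1_0(\Omega)]\times H^1_0(\Omega)$ there exist constants $C,c'>0$, where $C$ may depend on $(u_0,u_1)$, such that the solution $u$ of the nonlinear damped wave equation satisfies $$E(u(t))\le C\,G^{-1}\!\left(\frac{c'}{t}\right)\big((r-1)+X(u_0,u_1)\big)\qquad\text{for } t \text{ sufficiently large.}$$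
   Context: $\Omega$ is a bounded connected open set of $\mathbb{R}^n$, $n>1$, with $\mathcal{C}^2$ boundary $\partial\Omega$. $M=(\alpha^{ij})_{1\le i,j\le n}\in\mathcal{C}^\infty(\bar\Omega;\mathbb{R}^{n\times n})$ is a symmetric, uniformly positive definite matrix. In this statement $\Delta$ denotes $\sum_{i,j=1}^n\partial_{x_i}(\alpha^{ij}\partial_{x_j})$ and $\nabla$ denotes $\big(\sum_{j}\beta^{1j}\partial_{x_j},\dots,\sum_j\beta^{nj}\partial_{x_j}\big)$, where $(\beta^{ij})=M^{1/2}$, so that $|\nabla u|^2=\sum_{i,j}\alpha^{ij}\partial_{x_i}u\,\partial_{x_j}u$. The norm on $H^1_0(\Omega)$ is $\|v\|_{H^1_0(\Omega)}=\|\nabla v\|_{L^2(\Omega)}$. $a\in L^\infty(\Omega)$ with $a(x)\ge0$ for all $x\in\Omega$. $g:\mathbb{R}\to\mathbb{R}$ is continuous, strictly increasing, $g(0)=0$, $sg(s)\ge0$, and: (i) there are $r\in[1,\infty)$ and $c_1,c_2>0$ such that $|s|\le1\Rightarrow c_1|s|^r\le|g(s)|\le c_2|s|^{1/r}$; (ii) there are $k\in[0,1]$, $p\in[1,\infty)$ and $c_3,c_4>0$ such that $|s|>1\Rightarrow c_3|s|^k\le|g(s)|\le c_4|s|^p$; (iii) $(n-2)(1-k)\le4r$ and $(n-2)(p-1)\le1$. For $(u_0,u_1)\in[H^2(\Omega)\cap H^1_0(\Omega)]\times H^1_0(\Omega)$ the nonlinear damped wave equation has a unique solution $u\in\mathcal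 C([0,+\infty),H^1_0(\Omega))\cap\mathcal C^1([0,+\infty),L^2(\Omega))$, and $u\in L^\infty(0,+\infty;H^2(\Omega)\cap H^1_0(\Omega))\cap W^{1,\infty}(0,+\infty;H^1_0(\Omega))\cap W^{2,\infty}(0,+\infty;L^2(\Omega))$. Its energy is $E(u(t))=\frac12\int_\Omega\big(|\partial_tu(x,t)|^2+|\nabla u(x,t)|^2\big)dx$, which is non-increasing and satisfies $E(u(t_2))-E(u(t_1))=-\int_{t_1}^{t_2}\int_\Omega a(x)g(\partial_tu)\partial_tu\,dx\,dt$ for $t_2>t_1\ge0$. In particular $E(u(0))=\frac12\int_\Omega(|u_1|^2+|\nabla u_0|^2)\,dx$ depends only on $(u_0,u_1)$. Further, $$E_1(u(0))=\|(\Delta u_0-a\,g(u_1),u_1)\|^2_{L^2(\Omega)\times H^1_0(\Omega)},$$ $$X(u_0,u_1)=E(u(0))+E_1(u(0))+[E_1(u(0))]^{2p-1}+[E_1(u(0))]^{1+\frac{r-k}{r+1}}.$$ $\mathcal{F}^{-1}$ and $G^{-1}$ denote inverse functions on $[0,+\infty)$. *)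

theory Defs
  imports "HOL-Analysis.Analysis"
begin

section \<open>Functions of class $C^k$, smooth boundaries\<close>

text \<open>On an open set of a finite-dimensional space this is the usual class $C^k$: all iterated
  directional derivatives up to order \<open>k\<close> exist (in the Frechet sense) and are continuous.\<close>

primrec Ck_on :: "nat \<Rightarrow> 'a::real_normed_vector set \<Rightarrow> ('a \<Rightarrow> 'b::real_normed_vector) \<Rightarrow> bool" where
  "Ck_on 0 S f \<longleftrightarrow> continuous_on S f"
| "Ck_on (Suc k) S f \<longleftrightarrow>
     (\<forall>x\<in>S. f differentiable (at x)) \<and> (\<forall>v. Ck_on k S (\<lambda>x. frechet_derivative f (at x) v))"

text \<open>$C^\infty(\bar\Omega)$ as the restrictions to $\bar\Omega$ of smooth functions on the whole space.\<close>

definition smooth_on_closure ::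
  "(real^'n) set \<Rightarrow> (real^'n \<Rightarrow> 'b::real_normed_vector) \<Rightarrow> bool" where
  "smooth_on_closure \<Omega> f \<longleftrightarrow> (\<exists>F. (\<forall>k. Ck_on k UNIV F) \<and> (\<forall>x\<in>closure \<Omega>. F x = f x))"

text \<open>Near each boundary point, $\Omega$ is the part above the graph of a $C^2$ function: \<open>\<nu>\<close> is the
  direction of the vertical axis and \<open>\<gamma>\<close>, being constant along \<open>\<nu>\<close>, is a function of the remaining
  $n-1$ orthonormal coordinates.\<close>

definition C2_boundary :: "(real^'n) set \<Rightarrow> bool" where
  "C2_boundary \<Omega> \<longleftrightarrow>
     (\<forall>x0\<in>frontier \<Omega>. \<exists>\<rho>>0. \<exists>\<nu> \<gamma>. norm \<nu> = 1 \<and> Ck_on 2 UNIV \<gamma> \<and>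
        (\<forall>x t. \<gamma> (x + t *\<^sub>R \<nu>) = \<gamma> x) \<and>
        \<Omega> \<inter> ball x0 \<rho> = {x \<in> ball x0 \<rho>. \<gamma> x < x \<bullet> \<nu>})"


section \<open>Lebesgue and Sobolev spaces\<close>

text \<open>Elements of the spaces are functions on the whole of \<open>real^'n\<close>, of which only the values on
  $\Omega$, up to Lebesgue-null sets, are relevant.\<close>

definition Linf_space :: "(real^'n) set \<Rightarrow> (real^'n \<Rightarrow> real) set" where
  "Linf_space \<Omega> = {f. set_borel_measurable lebesgue \<Omega> f \<and>
                       (\<exists>K. AE x in lebesgue. x \<in> \<Omega> \<longrightarrow> \<bar>f x\<bar> \<le> K)}"

definition L2 :: "(real^'n) set \<Rightarrow> (real^'n \<Rightarrow> real) set" where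
  "L2 \<Omega> = {f. set_borel_measurable lebesgue \<Omega> f \<and> set_integrable lebesgue \<Omega> (\<lambda>x. (f x)\<^sup>2)}"

definition L2_norm :: "(real^'n) set \<Rightarrow> (real^'n \<Rightarrow> real) \<Rightarrow> real" where
  "L2_norm \<Omega> f = sqrt (LINT x:\<Omega>|lebesgue. (f x)\<^sup>2)"

definition test_functions :: "(real^'n) set \<Rightarrow> (real^'n \<Rightarrow> real) set" where
  "test_functions \<Omega> = {\<phi>. (\<forall>k. Ck_on k UNIV \<phi>) \<and>
                           (\<exists>K. compact K \<and> K \<subseteq> \<Omega> \<and> (\<forall>x. x \<notin> K \<longrightarrow> \<phi> x = 0))}"

definition partial_deriv :: "'n \<Rightarrow> (real^'n \<Rightarrow> real) \<Rightarrow> real^'n \<Rightarrow> real" where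
  "partial_deriv i \<phi> x = frechet_derivative \<phi> (at x) (axis i 1)"

definition is_weak_deriv ::
  "(real^'n) set \<Rightarrow> 'n \<Rightarrow> (real^'n \<Rightarrow> real) \<Rightarrow> (real^'n \<Rightarrow> real) \<Rightarrow> bool" where
  "is_weak_deriv \<Omega> i f g \<longleftrightarrow> g \<in> L2 \<Omega> \<and>
     (\<forall>\<phi>\<in>test_functions \<Omega>.
        (LINT x:\<Omega>|lebesgue. f x * partial_deriv i \<phi> x) = - (LINT x:\<Omega>|lebesgue. g x * \<phi> x))"

text \<open>A representative; the weak derivative is unique almost everywhere on $\Omega$.\<close>

definition weak_deriv :: "(real^'n) set \<Rightarrow> 'n \<Rightarrow> (real^'n \<Rightarrow> real) \<Rightarrow> real^'n \<Rightarrow> real" where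
  "weak_deriv \<Omega> i f = (SOME g. is_weak_deriv \<Omega> i f g)"

definition H1 :: "(real^'n) set \<Rightarrow> (real^'n \<Rightarrow> real) set" where
  "H1 \<Omega> = {f \<in> L2 \<Omega>. \<forall>i. \<exists>g. is_weak_deriv \<Omega> i f g}"

definition H2 :: "(real^'n) set \<Rightarrow> (real^'n \<Rightarrow> real) set" where
  "H2 \<Omega> = {f \<in> H1 \<Omega>. \<forall>i. weak_deriv \<Omega> i f \<in> H1 \<Omega>}"

definition H2_norm :: "(real^'n) set \<Rightarrow> (real^'n \<Rightarrow> real) \<Rightarrow> real" where
  "H2_norm \<Omega> f = sqrt ((L2_norm \<Omega> f)\<^sup>2 + (\<Sum>i\<in>UNIV. (L2_norm \<Omega> (weak_deriv \<Omega> i f))\<^sup>2)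
                   + (\<Sum>i\<in>UNIV. \<Sum>j\<in>UNIV. (L2_norm \<Omega> (weak_deriv \<Omega> i (weak_deriv \<Omega> j f)))\<^sup>2))"

text \<open>$H^1_0(\Omega)$ is the closure of the test functions in $H^1(\Omega)$.\<close>

definition H10 :: "(real^'n) set \<Rightarrow> (real^'n \<Rightarrow> real) set" where
  "H10 \<Omega> = {f \<in> H1 \<Omega>. \<forall>\<epsilon>>0. \<exists>\<phi>\<in>test_functions \<Omega>.
               L2_norm \<Omega> (\<lambda>x. f x - \<phi> x) < \<epsilon> \<and>
               (\<forall>i. L2_norm \<Omega> (\<lambda>x. weak_deriv \<Omega> i f x - partial_deriv i \<phi> x) < \<epsilon>)}"


section \<open>The operators attached to the matrix field\<close>

text \<open>The positive semidefinite square root of a symmetric positive semidefinite matrix.  It is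
  unique, so the choice operator merely names it.\<close>

definition matrix_sqrt :: "real^'n^'n \<Rightarrow> real^'n^'n" where
  "matrix_sqrt A = (SOME B. transpose B = B \<and> (\<forall>\<xi>. 0 \<le> \<xi> \<bullet> (B *v \<xi>)) \<and> B ** B = A)"

definition nabla ::
  "(real^'n \<Rightarrow> real^'n^'n) \<Rightarrow> (real^'n) set \<Rightarrow> (real^'n \<Rightarrow> real) \<Rightarrow> real^'n \<Rightarrow> real^'n" where
  "nabla M \<Omega> f x = matrix_sqrt (M x) *v (\<chi> j. weak_deriv \<Omega> j f x)"

definition laplace ::
  "(real^'n \<Rightarrow> real^'n^'n) \<Rightarrow> (real^'n) set \<Rightarrow> (real^'n \<Rightarrow> real) \<Rightarrow> real^'n \<Rightarrow> real" where
  "laplace M \<Omega> f x =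
     (\<Sum>i\<in>UNIV. \<Sum>j\<in>UNIV. weak_deriv \<Omega> i (\<lambda>y. M y $ i $ j * weak_deriv \<Omega> j f y) x)"

definition H10_norm ::
  "(real^'n \<Rightarrow> real^'n^'n) \<Rightarrow> (real^'n) set \<Rightarrow> (real^'n \<Rightarrow> real) \<Rightarrow> real" where
  "H10_norm M \<Omega> f = sqrt (LINT x:\<Omega>|lebesgue. (norm (nabla M \<Omega> f x))\<^sup>2)"


section \<open>Functions of time with values in a function space\<close>

text \<open>A function $u(x,t)$ is written \<open>u t x\<close>.  A normed function space is given by its set \<open>X\<close> of
  elements and its norm \<open>N\<close>.\<close>

definition continuous_in ::
  "(real^'n \<Rightarrow> real) set \<Rightarrow> ((real^'n \<Rightarrow> real) \<Rightarrow> real) \<Rightarrow> (real \<Rightarrow> real^'n \<Rightarrow> real) \<Rightarrow> bool" where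
  "continuous_in X N u \<longleftrightarrow>
     (\<forall>t\<ge>0. u t \<in> X \<and> ((\<lambda>s. N (\<lambda>x. u s x - u t x)) \<longlongrightarrow> 0) (at t within {0..}))"

text \<open>Time derivative on $[0,+\infty)$ with respect to the norm \<open>N\<close>; one-sided at time $0$.\<close>

definition has_time_deriv ::
  "(real^'n \<Rightarrow> real) set \<Rightarrow> ((real^'n \<Rightarrow> real) \<Rightarrow> real) \<Rightarrow>
   (real \<Rightarrow> real^'n \<Rightarrow> real) \<Rightarrow> (real^'n \<Rightarrow> real) \<Rightarrow> real \<Rightarrow> bool" where
  "has_time_deriv X N u w t \<longleftrightarrow> w \<in> X \<and>
     ((\<lambda>s. N (\<lambda>x. (u s x - u t x) / (s - t) - w x)) \<longlongrightarrow> 0) (at t within {0..})"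

text \<open>The function $\partial_t u(\cdot,t)$, as derivative in $L^2(\Omega)$; unique almost everywhere on
  $\Omega$ whenever it exists.\<close>

definition ddt :: "(real^'n) set \<Rightarrow> (real \<Rightarrow> real^'n \<Rightarrow> real) \<Rightarrow> real \<Rightarrow> real^'n \<Rightarrow> real" where
  "ddt \<Omega> u t = (SOME w. has_time_deriv (L2 \<Omega>) (L2_norm \<Omega>) u w t)"

text \<open>$u\in L^\infty(0,+\infty;X)$.  Strong measurability is not listed: the functions to which
  this and the next definition are applied are continuous in time with values in $L^2(\Omega)$, and \<open>X\<close>
  is a separable Hilbert space continuously embedded in $L^2(\Omega)$, which gives it automatically.\<close>

definition Linf_in ::
  "(real^'n \<Rightarrow> real) set \<Rightarrow> ((real^'n \<Rightarrow> real) \<Rightarrow> real) \<Rightarrow> (real \<Rightarrow> real^'n \<Rightarrow> real) \<Rightarrow> bool" where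
  "Linf_in X N u \<longleftrightarrow> (\<exists>K. AE t in lebesgue. 0 < t \<longrightarrow> u t \<in> X \<and> N (u t) \<le> K)"

text \<open>$u\in W^{1,\infty}(0,+\infty;X)$ for the continuous representative and a Hilbert space \<open>X\<close>
  contained in $L^2(\Omega)$: bounded, Lipschitz, with derivative almost everywhere in the norm of \<open>X\<close>
  (so the derivative is essentially bounded, by the Lipschitz constant).\<close>

definition W1inf_in ::
  "(real^'n) set \<Rightarrow> (real^'n \<Rightarrow> real) set \<Rightarrow> ((real^'n \<Rightarrow> real) \<Rightarrow> real) \<Rightarrow>
   (real \<Rightarrow> real^'n \<Rightarrow> real) \<Rightarrow> bool" where
  "W1inf_in \<Omega> X N u \<longleftrightarrow>
     (\<exists>K. \<forall>t\<ge>0. u t \<in> X \<and> N (u t) \<le> K) \<and>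
     (\<exists>L. \<forall>s\<ge>0. \<forall>t\<ge>0. N (\<lambda>x. u s x - u t x) \<le> L * \<bar>s - t\<bar>) \<and>
     (AE t in lebesgue. 0 < t \<longrightarrow> has_time_deriv X N u (ddt \<Omega> u t) t)"


section \<open>The wave equations\<close>

text \<open>\<open>u\<close> is the solution of $\partial_t^2u-\Delta u+a\,g(\partial_tu)=0$ in $\Omega\times(0,+\infty)$, $u=0$ on
  $\partial\Omega\times(0,+\infty)$, $(u,\partial_tu)(\cdot,0)=(u_0,u_1)$, in the regularity class of the
  solutions with data in $[H^2(\Omega)\cap H^1_0(\Omega)]\times H^1_0(\Omega)$.  The boundary condition is
  contained in $u(\cdot,t)\in H^1_0(\Omega)$.\<close>

definition damped_wave_solution ::
  "(real^'n \<Rightarrow> real^'n^'n) \<Rightarrow> (real^'n) set \<Rightarrow> (real^'n \<Rightarrow> real) \<Rightarrow> (real \<Rightarrow> real) \<Rightarrow>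
   (real^'n \<Rightarrow> real) \<Rightarrow> (real^'n \<Rightarrow> real) \<Rightarrow> (real \<Rightarrow> real^'n \<Rightarrow> real) \<Rightarrow> bool" where
  "damped_wave_solution M \<Omega> a g u0 u1 u \<longleftrightarrow>
     continuous_in (H10 \<Omega>) (H10_norm M \<Omega>) u \<and>
     (\<forall>t\<ge>0. has_time_deriv (L2 \<Omega>) (L2_norm \<Omega>) u (ddt \<Omega> u t) t) \<and>
     continuous_in (L2 \<Omega>) (L2_norm \<Omega>) (ddt \<Omega> u) \<and>
     Linf_in (H2 \<Omega> \<inter> H10 \<Omega>) (H2_norm \<Omega>) u \<and>
     W1inf_in \<Omega> (H10 \<Omega>) (H10_norm M \<Omega>) u \<and>
     W1inf_in \<Omega> (L2 \<Omega>) (L2_norm \<Omega>) u \<and>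
     W1inf_in \<Omega> (L2 \<Omega>) (L2_norm \<Omega>) (ddt \<Omega> u) \<and>
     (AE t in lebesgue. 0 < t \<longrightarrow> (AE x in lebesgue. x \<in> \<Omega> \<longrightarrow>
        ddt \<Omega> (ddt \<Omega> u) t x - laplace M \<Omega> (u t) x + a x * g (ddt \<Omega> u t x) = 0)) \<and>
     (AE x in lebesgue. x \<in> \<Omega> \<longrightarrow> u 0 x = u0 x \<and> ddt \<Omega> u 0 x = u1 x)"

definition wave_solution ::
  "(real^'n \<Rightarrow> real^'n^'n) \<Rightarrow> (real^'n) set \<Rightarrow>
   (real^'n \<Rightarrow> real) \<Rightarrow> (real^'n \<Rightarrow> real) \<Rightarrow> (real \<Rightarrow> real^'n \<Rightarrow> real) \<Rightarrow> bool" where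
  "wave_solution M \<Omega> u0 u1 \<phi> \<longleftrightarrow> damped_wave_solution M \<Omega> (\<lambda>x. 0) (\<lambda>s. 0) u0 u1 \<phi>"

text \<open>Energy of the state \<open>(v, w)\<close>: $E(u(t))$ is \<open>energy M \<Omega> (u t) (ddt \<Omega> u t)\<close>, and $E(u(0))$ is
  \<open>energy M \<Omega> u0 u1\<close>.\<close>

definition energy ::
  "(real^'n \<Rightarrow> real^'n^'n) \<Rightarrow> (real^'n) set \<Rightarrow> (real^'n \<Rightarrow> real) \<Rightarrow> (real^'n \<Rightarrow> real) \<Rightarrow> real" where
  "energy M \<Omega> v w = 1/2 * (LINT x:\<Omega>|lebesgue. \<bar>w x\<bar>\<^sup>2 + (norm (nabla M \<Omega> v x))\<^sup>2)"

definition energy1 ::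
  "(real^'n \<Rightarrow> real^'n^'n) \<Rightarrow> (real^'n) set \<Rightarrow> (real^'n \<Rightarrow> real) \<Rightarrow> (real \<Rightarrow> real) \<Rightarrow>
   (real^'n \<Rightarrow> real) \<Rightarrow> (real^'n \<Rightarrow> real) \<Rightarrow> real" where
  "energy1 M \<Omega> a g u0 u1 =
     (L2_norm \<Omega> (\<lambda>x. laplace M \<Omega> u0 x - a x * g (u1 x)))\<^sup>2 + (H10_norm M \<Omega> u1)\<^sup>2"

definition X_data ::
  "(real^'n \<Rightarrow> real^'n^'n) \<Rightarrow> (real^'n) set \<Rightarrow> (real^'n \<Rightarrow> real) \<Rightarrow> (real \<Rightarrow> real) \<Rightarrow>
   real \<Rightarrow> real \<Rightarrow> real \<Rightarrow> (real^'n \<Rightarrow> real) \<Rightarrow> (real^'n \<Rightarrow> real) \<Rightarrow> real" where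
  "X_data M \<Omega> a g r k p u0 u1 =
     energy M \<Omega> u0 u1 + energy1 M \<Omega> a g u0 u1
     + energy1 M \<Omega> a g u0 u1 powr (2 * p - 1)
     + energy1 M \<Omega> a g u0 u1 powr (1 + (r - k) / (r + 1))"

definition Lambda_data ::
  "(real^'n \<Rightarrow> real^'n^'n) \<Rightarrow> (real^'n) set \<Rightarrow> (real^'n \<Rightarrow> real) \<Rightarrow> (real \<Rightarrow> real) \<Rightarrow>
   real \<Rightarrow> real \<Rightarrow> real \<Rightarrow> (real^'n \<Rightarrow> real) \<Rightarrow> (real^'n \<Rightarrow> real) \<Rightarrow> real" where
  "Lambda_data M \<Omega> a g r k p u0 u1 =
     ((r - 1) + X_data M \<Omega> a g r k p u0 u1) / energy M \<Omega> u0 u1"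

definition zero_data :: "(real^'n) set \<Rightarrow> (real^'n \<Rightarrow> real) \<Rightarrow> (real^'n \<Rightarrow> real) \<Rightarrow> bool" where
  "zero_data \<Omega> u0 u1 \<longleftrightarrow> (AE x in lebesgue. x \<in> \<Omega> \<longrightarrow> u0 x = 0 \<and> u1 x = 0)"

text \<open>Inverse of a bijection of $[0,+\infty)$ onto itself.\<close>

definition inv_nonneg :: "(real \<Rightarrow> real) \<Rightarrow> real \<Rightarrow> real" where
  "inv_nonneg f = inv_into {0..} f"

end

theory Submission
  imports Defs
begin

text \<open>The energy $e(t)=E(u(t))$ is Lipschitz on $[0,\infty)$, and for almost every $t$ its difference
  quotients converge to $\int\partial_t^2u\,\partial_tu+\nabla u\cdot\nabla\partial_tu
  =-\int a\,g(\partial_tu)\,\partial_tu$ by Green's formula; dominated convergence then gives the energy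
  identity, so the observation estimate becomes
  $e(s)\le c\,h\,D+c\,(e(s)-e(s+1/G(h)))$ with $D=(r-1)+X(u_0,u_1)\ge e(0)$.
  Applying it with $h_j=\rho^j$, $\rho=2c/(2c+1)$, successively at the times
  $s_j=\sum_{i<j}1/G(h_i)$ yields $e(s_j)\le(2c+1)h_jD$.  Since $G(\rho h)\le\rho\,G(h)$, the times are
  dominated by a geometric series, $s_{j+1}\le(2c+1)/G(h_j)$, and inverting $G$ gives the decay
  rate.\<close>

section \<open>Decay from an observation estimate\<close>

text \<open>The constants come from one recursion. Solved for the later energy, the observation
  estimate reads (1+c) e(s_{j+1}) \<le> c h_j D + c e(s_j). If e(s_j) \<le> \<kappa> h_j D, the
  right side is at most c (1+\<kappa>) h_j D, and \<kappa> = 2c+1 turns this into e(s_{j+1}) \<le>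
  2c h_j D, so the ratio \<rho> = 2c/\<kappa> closes the induction. Since 1/(1-\<rho>) is again
  \<kappa>, one number governs the energies, the sum of the times and the rate. The obstacle is the
  energy identity. The equation holds only at almost every time, and \<open>weak_deriv\<close> and
  \<open>ddt\<close> are arbitrary representatives, linear only up to null sets. Hence the energy is
  treated as a bilinear form on pointwise pairs (velocity, gradient), where algebra is exact;
  uniqueness of weak derivatives, from the fundamental lemma of the calculus of variations, links
  these pairs to the Sobolev functions. \<open>matrix_sqrt\<close> is a choice as well, and the
  spectral theorem shows that it denotes a square root.\<close>

lemma geometric_time_sum_bound:
  fixes G :: "real \<Rightarrow> real" and \<rho> :: real
  assumes \<rho>: "0 < \<rho>" "\<rho> < 1"
    and pos: "\<And>h. h > 0 \<Longrightarrow> G h > 0"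
    and scale: "\<And>h. h > 0 \<Longrightarrow> G (\<rho> * h) \<le> \<rho> * G h"
  shows "(\<Sum>i<Suc j. 1 / G (\<rho> ^ i)) \<le> 1 / ((1 - \<rho>) * G (\<rho> ^ j))"
proof (induction j)
  case 0
  have "1 / G 1 * 1 \<le> 1 / G 1 * (1 / (1 - \<rho>))"
    using \<rho> pos[of 1] by (intro mult_left_mono) (auto simp: field_simps)
  then show ?case by (simp add: field_simps)
next
  case (Suc j)
  define A where "A = G (\<rho> ^ j)"
  define B where "B = G (\<rho> ^ Suc j)"
  have AB: "A > 0" "B > 0" "B \<le> \<rho> * A"
    using pos scale[of "\<rho> ^ j"] \<rho> by (auto simp: A_def B_def)
  \<comment> \<open>Each summand is at most \<rho> times the next one, so the last one dominates the
    sum.\<close>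
  have "1 / A \<le> \<rho> / B" using AB by (simp add: field_simps)
  then have "(1 / A) / (1 - \<rho>) \<le> (\<rho> / B) / (1 - \<rho>)"
    by (rule divide_right_mono) (use \<rho> in simp)
  then have "1 / ((1 - \<rho>) * A) \<le> (\<rho> / B) / (1 - \<rho>)"
    by (simp add: mult.commute)
  moreover have "(\<rho> / B) / (1 - \<rho>) + 1 / B = 1 / ((1 - \<rho>) * B)"
    using \<rho> AB by (simp add: divide_simps)
  ultimately show ?case using Suc by (simp add: A_def B_def)
qed

text \<open>The wave equation contributes only monotonicity of \<open>e\<close>, the initial bound
  by \<open>D\<close>, and the estimate with the dissipated energy already written as a difference
  of energies.\<close>

lemma decay_from_observation:
  fixes e G :: "real \<Rightarrow> real" and c D :: real
  assumes c: "c > 0"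
    and e_decr: "\<And>s t. 0 \<le> s \<Longrightarrow> s \<le> t \<Longrightarrow> e t \<le> e s"
    and e_0: "e 0 \<le> D" and D: "D \<ge> 0"
    and G_pos: "\<And>h. h > 0 \<Longrightarrow> G h > 0"
    and G_mono: "strict_mono_on {0..} G"
    and G_surj: "G ` {0..} = {0..}"
    and scale: "\<And>h \<sigma>. h > 0 \<Longrightarrow> 0 < \<sigma> \<Longrightarrow> \<sigma> < 1 \<Longrightarrow> G (\<sigma> * h) \<le> \<sigma> * G h"
    and est: "\<And>h s. h > 0 \<Longrightarrow> s \<ge> 0 \<Longrightarrow> e s \<le> c * h * D + c * (e s - e (s + 1 / G h))"
    and t: "t > 0"
  shows "e t \<le> (2 * c + 1) * inv_into {0..} G ((2 * c + 1) / t) * D"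
proof -
  define \<rho> where "\<rho> = 2 * c / (2 * c + 1)"
  define \<kappa> where "\<kappa> = 2 * c + 1"
  have \<rho>: "0 < \<rho>" "\<rho> < 1" and \<kappa>: "\<kappa> > 1" and K: "1 / (1 - \<rho>) = \<kappa>" and \<rho>\<kappa>: "\<rho> * \<kappa> = 2 * c"
    using c by (auto simp: \<rho>_def \<kappa>_def field_simps)
  define S where "S j = (\<Sum>i<j. 1 / G (\<rho> ^ i))" for j
  have S_nonneg: "S j \<ge> 0" for j
    unfolding S_def using G_pos \<rho> by (intro sum_nonneg) (simp add: less_imp_le)
  have step: "e (S j) \<le> \<kappa> * \<rho> ^ j * D" for j
  proof (induction j)
    case 0
    have "D \<le> \<kappa> * D" using \<kappa> D by (simp add: mult_le_cancel_right1)
    then show ?case using e_0 by (simp add: S_def)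
  next
    case (Suc j)
    have S: "S (Suc j) = S j + 1 / G (\<rho> ^ j)" by (simp add: S_def)
    have "e (S j) \<le> c * \<rho> ^ j * D + c * (e (S j) - e (S (Suc j)))"
      unfolding S using est[of "\<rho> ^ j" "S j"] \<rho> S_nonneg by simp
    moreover have "e (S (Suc j)) \<le> e (S j)"
      using e_decr[of "S j" "S (Suc j)"] S_nonneg S G_pos[of "\<rho> ^ j"] \<rho> by simp
    \<comment> \<open>Monotonicity replaces the left-hand \<open>e (S j)\<close> by the later
      energy, which joins the copy with factor \<open>c\<close>.\<close>
    ultimately have "(1 + c) * e (S (Suc j)) \<le> c * \<rho> ^ j * D + c * e (S j)"
      by (simp add: algebra_simps)
    also have "\<dots> \<le> c * \<rho> ^ j * D + c * (\<kappa> * \<rho> ^ j * D)"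
      using Suc c by simp
    also have "\<dots> = (1 + c) * (2 * c) * \<rho> ^ j * D"
      by (simp add: \<kappa>_def algebra_simps)
    also have "\<dots> = (1 + c) * (\<kappa> * \<rho> ^ Suc j * D)"
      unfolding \<rho>\<kappa>[symmetric] by simp
    finally show ?case using c by simp
  qed
  \<comment> \<open>The times tend to infinity at least linearly: no waiting time is shorter than
    the first one, \<open>1 / G 1\<close>.\<close>
  have S_ge: "S j \<ge> real j * (1 / G 1)" for j
  proof -
    have "real j * (1 / G 1) = (\<Sum>i<j. 1 / G 1)" by simp
    also have "\<dots> \<le> S j" unfolding S_def
    proof (intro sum_mono)
      fix i
      have "G (\<rho> ^ i) \<le> G 1"
        using strict_mono_on_leD[OF G_mono, of "\<rho> ^ i" 1] \<rho> by (simp add: power_le_one)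
      then show "1 / G 1 \<le> 1 / G (\<rho> ^ i)"
        using G_pos[of 1] G_pos[of "\<rho> ^ i"] \<rho> by (simp add: frac_le)
    qed
    finally show ?thesis .
  qed
  obtain N where "real N * (1 / G 1) > t"
    using reals_Archimedean3[of "1 / G 1"] G_pos[of 1] by auto
  then have "t < S N" using S_ge[of N] by linarith
  then have ex: "\<exists>j. t < S j" ..
  \<comment> \<open>The first index whose time exceeds \<open>t\<close>, so that
    \<open>S j \<le> t < S (Suc j)\<close> for its predecessor \<open>j\<close>. The left half
    bounds the energy at \<open>t\<close>, the right half bounds \<open>t\<close> by the geometric
    sum.\<close>
  define m where "m = (LEAST j. t < S j)"
  have m: "t < S m" using ex unfolding m_def by (rule LeastI_ex)
  have "m \<noteq> 0" using m t by (cases "m = 0") (auto simp: S_def)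
  then obtain j where j: "m = Suc j" using not0_implies_Suc by blast
  have Sj: "S j \<le> t"
    using not_less_Least[of j "\<lambda>j. t < S j"] j m_def by (simp add: not_less)
  have "t < \<kappa> / G (\<rho> ^ j)"
  proof -
    have "S (Suc j) \<le> 1 / ((1 - \<rho>) * G (\<rho> ^ j))"
      unfolding S_def
      by (rule geometric_time_sum_bound) (use \<rho> G_pos scale in auto)
    also have "\<dots> = \<kappa> / G (\<rho> ^ j)"
      using arg_cong[OF K, of "\<lambda>x. x / G (\<rho> ^ j)"] by (simp only: divide_divide_eq_left)
    finally show ?thesis using m j by simp
  qed
  then have "G (\<rho> ^ j) < \<kappa> / t"
    using t G_pos[of "\<rho> ^ j"] \<rho> by (simp add: field_simps)
  moreover define y where "y = inv_into {0..} G (\<kappa> / t)"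
  have "\<kappa> / t \<in> G ` {0..}" using G_surj t \<kappa> by simp
  then have y: "y \<ge> 0" "G y = \<kappa> / t"
    using inv_into_into[of "\<kappa> / t" G "{0..}"] f_inv_into_f[of "\<kappa> / t" G "{0..}"]
    by (auto simp: y_def)
  \<comment> \<open>If \<open>y < \<rho> ^ j\<close>, monotonicity would give
    \<open>G y \<le> G (\<rho> ^ j) < \<kappa> / t = G y\<close>.\<close>
  ultimately have "\<rho> ^ j \<le> y"
    using strict_mono_on_leD[OF G_mono, of y "\<rho> ^ j"] \<rho> by (metis atLeast_iff linorder_not_le order_less_imp_le zero_le_power)
  then have "\<kappa> * \<rho> ^ j * D \<le> \<kappa> * y * D"
    using \<kappa> D by (intro mult_right_mono mult_left_mono) auto
  moreover have "e t \<le> e (S j)" using e_decr S_nonneg Sj by blast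
  ultimately show ?thesis using step[of j] by (simp add: \<kappa>_def y_def)
qed

section \<open>Growth and inversion of the weight\<close>

text \<open>The scaling inequality is the core: since \<open>\<F>\<close> is increasing, shrinking
  the argument by \<open>\<sigma>\<close> gains the factor \<open>\<sigma> powr (2 * r + 1)\<close>,
  which is at most \<open>\<sigma>\<close>. Strict monotonicity and unboundedness are read off from
  it; continuity supplies the intermediate values.\<close>

lemma weight_properties:
  fixes \<G> \<F> G :: "real \<Rightarrow> real" and C2 r :: real
  assumes \<G>: "continuous_on {0..} \<G>" "strict_mono_on {0..} \<G>" "bij_betw \<G> {0..} {0..}"
    and \<F>: "\<And>x. x \<ge> 0 \<Longrightarrow> \<F> x = x * (\<G> x)\<^sup>2"
    and C2: "C2 > 0" and r: "r \<ge> 1"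
    and G: "\<And>h. h \<ge> 0 \<Longrightarrow> G h = C2 * h powr (2 * r + 1) * \<F> h powr (4 * (r + 1))"
  shows weight_pos: "\<And>h. h > 0 \<Longrightarrow> G h > 0"
    and weight_strict_mono: "strict_mono_on {0..} G"
    and weight_surj: "G ` {0..} = {0..}"
    and weight_scale: "\<And>h \<sigma>. h > 0 \<Longrightarrow> 0 < \<sigma> \<Longrightarrow> \<sigma> < 1 \<Longrightarrow> G (\<sigma> * h) \<le> \<sigma> * G h"
proof -
  have \<G>_nonneg: "\<G> x \<ge> 0" if "x \<ge> 0" for x
    using \<G>(3) that by (auto dest: bij_betwE)
  have \<G>_pos: "\<G> x > 0" if "x > 0" for x
    using strict_mono_onD[OF \<G>(2), of 0 x] \<G>_nonneg[of 0] that by simp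
  have \<F>_pos: "\<F> x > 0" if "x > 0" for x using \<F>[of x] \<G>_pos[OF that] that by simp
  have \<F>_nonneg: "\<F> x \<ge> 0" if "x \<ge> 0" for x using \<F>[of x] that by simp
  have \<F>_mono: "\<F> x \<le> \<F> y" if "0 \<le> x" "x \<le> y" for x y
    using \<F>[of x] \<F>[of y] that \<G>_nonneg[of x] strict_mono_on_leD[OF \<G>(2), of x y]
    by (auto intro!: mult_mono power_mono)
  show pos: "G h > 0" if "h > 0" for h
    using G[of h] \<F>_pos[OF that] that C2 by simp
  have G0: "G 0 = 0" using G[of 0] by simp
  have scale': "G (\<sigma> * h) \<le> \<sigma> powr (2 * r + 1) * G h" if "h \<ge> 0" "0 < \<sigma>" "\<sigma> \<le> 1" for h \<sigma>
  proof -
    have "\<sigma> * h \<le> h" using that by (simp add: mult_left_le_one_le)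
    then have "\<F> (\<sigma> * h) powr (4 * (r + 1)) \<le> \<F> h powr (4 * (r + 1))"
      using that r by (intro powr_mono2 \<F>_nonneg \<F>_mono) auto
    then have "C2 * (\<sigma> * h) powr (2 * r + 1) * \<F> (\<sigma> * h) powr (4 * (r + 1))
        \<le> C2 * (\<sigma> * h) powr (2 * r + 1) * \<F> h powr (4 * (r + 1))"
      using C2 by (intro mult_left_mono) auto
    then show ?thesis using that G by (simp add: powr_mult ac_simps)
  qed
  have powr_le: "\<sigma> powr (2 * r + 1) \<le> \<sigma>" if "0 < \<sigma>" "\<sigma> < 1" for \<sigma>
    using powr_mono'[of 1 "2 * r + 1" \<sigma>] that r by simp
  show scale: "G (\<sigma> * h) \<le> \<sigma> * G h" if "h > 0" "0 < \<sigma>" "\<sigma> < 1" for h \<sigma>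
    using scale'[of h \<sigma>] powr_le[of \<sigma>] pos[of h] that
    by (meson less_eq_real_def mult_right_mono order_trans)
  show mono: "strict_mono_on {0..} G"
  proof (rule strict_mono_onI)
    fix x y :: real assume xy: "x \<in> {0..}" "y \<in> {0..}" "x < y"
    show "G x < G y"
    proof (cases "x = 0")
      case False
      \<comment> \<open>\<open>x\<close> is \<open>y\<close> shrunk by the factor
        \<open>x / y\<close>, so scaling applies.\<close>
      then have "G x \<le> x / y * G y" using scale[of y "x / y"] xy by simp
      also have "\<dots> < 1 * G y" using xy pos[of y] by (intro mult_strict_right_mono) auto
      finally show ?thesis by simp
    qed (use xy G0 pos in auto)
  qed
  have cont: "continuous_on {0..} G"
  proof -
    \<comment> \<open>The exponents are positive, so \<open>powr\<close> stays continuous at 0,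
      where its base vanishes.\<close>
    have "continuous_on {0..} (\<lambda>h. C2 * h powr (2 * r + 1) * (h * (\<G> h)\<^sup>2) powr (4 * (r + 1)))"
      using r by (intro continuous_on_mult continuous_on_powr' continuous_on_power
          continuous_on_const continuous_on_id \<G>(1)) auto
    then show ?thesis by (rule continuous_on_eq) (use G \<F> in simp)
  qed
  show "G ` {0..} = {0..}"
  proof (intro equalityI subsetI)
    fix y assume "y \<in> G ` {0..}"
    then show "y \<in> {0..}" using pos G0 by (auto simp: le_less)
  next
    fix y :: real assume y: "y \<in> {0..}"
    \<comment> \<open>Scaling from \<open>b\<close> down to 1 gives
      \<open>b * G 1 \<le> G b\<close>, and this \<open>b\<close> makes the left side at least
      \<open>y\<close>.\<close>
    define b where "b = 1 + y / G 1"
    have b: "b \<ge> 1" using y pos[of 1] by (simp add: b_def)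
    have "y \<le> b * G 1" using pos[of 1] by (simp add: b_def distrib_right)
    also have "b * G 1 \<le> G b"
    proof (cases "b = 1")
      case False
      then show ?thesis using scale[of b "1 / b"] b by (simp add: field_simps)
    qed simp
    finally have "\<exists>x\<ge>0. x \<le> b \<and> G x = y"
      using y b G0 by (intro IVT' continuous_on_subset[OF cont]) auto
    then show "y \<in> G ` {0..}" by force
  qed
qed

section \<open>Recovering a Lipschitz function from its difference quotients\<close>

text \<open>The integral of a difference quotient telescopes to a difference of two averages of
  \<open>e\<close> over short intervals at the end points. The averages converge by continuity, the
  quotients are bounded by \<open>L\<close>, and dominated convergence equates the two limits.
  Forward steps keep every argument in [0,\<infinity>).\<close>

lemma lipschitz_integral_of_difference_quotient_limit:
  fixes e d :: "real \<Rightarrow> real"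
  assumes lip: "\<And>s t. 0 \<le> s \<Longrightarrow> 0 \<le> t \<Longrightarrow> \<bar>e s - e t\<bar> \<le> L * \<bar>s - t\<bar>"
    and lim: "AE t in lebesgue. 0 < t \<longrightarrow>
           (\<lambda>n. (e (t + 1 / Suc n) - e t) * Suc n) \<longlonglongrightarrow> d t"
    and ab: "0 \<le> \<alpha>" "\<alpha> \<le> \<beta>"
  shows "set_integrable lebesgue {\<alpha>..\<beta>} d"
    and "(LINT t:{\<alpha>..\<beta>}|lebesgue. d t) = e \<beta> - e \<alpha>"
proof -
  define q where "q n t = (e (t + 1 / Suc n) - e t) * Suc n" for n t
  define \<mu> where "\<mu> = lebesgue_on {\<alpha>..\<beta>}"
  have cont: "continuous_on {0..} e"
  proof (rule lipschitz_on_continuous_on)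
    \<comment> \<open>The sign of \<open>L\<close> is not given, and a Lipschitz constant must be
      nonnegative.\<close>
    show "(max L 0)-lipschitz_on {0..} e"
    proof (rule lipschitz_onI)
      fix x y :: real assume "x \<in> {0..}" "y \<in> {0..}"
      then have "\<bar>e x - e y\<bar> \<le> L * \<bar>x - y\<bar>" using lip by simp
      also have "\<dots> \<le> max L 0 * \<bar>x - y\<bar>" by (intro mult_right_mono) auto
      finally show "dist (e x) (e y) \<le> max L 0 * dist x y" by (simp add: dist_real_def)
    qed simp
  qed
  have contq: "continuous_on {\<alpha>..\<beta>} (q n)" for n
    unfolding q_def using ab
    by (auto intro!: continuous_intros continuous_on_subset[OF cont]
        continuous_on_compose2[OF cont])
  have q_meas: "q n \<in> borel_measurable \<mu>" for n
    unfolding \<mu>_def by (rule continuous_imp_measurable_on_sets_lebesgue[OF contq]) simp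
  \<comment> \<open>Convergence is known for \<open>0 < t\<close>, while \<open>\<alpha>\<close> may
    be 0.\<close>
  have AE_pos: "AE t in lebesgue. t \<noteq> (0::real)"
    by (rule AE_I[of _ _ "{0}"]) auto
  have lim': "AE t in \<mu>. (\<lambda>n. q n t) \<longlonglongrightarrow> d t"
    unfolding \<mu>_def using lim AE_pos
    by (subst AE_restrict_space_iff, simp, use lim AE_pos in eventually_elim, use ab in \<open>auto simp: q_def\<close>)
  have bound: "AE t in \<mu>. norm (q n t) \<le> L" for n
    unfolding \<mu>_def
  proof (rule AE_I2)
    fix t assume "t \<in> space (lebesgue_on {\<alpha>..\<beta>})"
    then have "t \<ge> 0" using ab by simp
    then have "\<bar>e (t + 1 / Suc n) - e t\<bar> \<le> L * (1 / Suc n)"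
      using lip[of "t + 1 / Suc n" t] by simp
    then show "norm (q n t) \<le> L"
      by (simp add: q_def abs_mult del: of_nat_Suc) (simp add: field_simps del: of_nat_Suc)
  qed
  \<comment> \<open>\<open>d\<close> is known only as a limit almost everywhere; \<open>lim\<close>
    supplies a measurable function equal to it off a null set, whatever its value where the
    quotients diverge.\<close>
  have d_meas': "(\<lambda>t. indicator {\<alpha>..\<beta>} t * d t) \<in> borel_measurable lebesgue"
  proof (rule borel_measurable_AE)
    show "(\<lambda>t. lim (\<lambda>n. indicator {\<alpha>..\<beta>} t * q n t)) \<in> borel_measurable lebesgue"
      using q_meas unfolding \<mu>_def
      by (intro borel_measurable_lim_metric) (simp add: borel_measurable_restrict_space_iff)
    show "AE t in lebesgue. lim (\<lambda>n. indicator {\<alpha>..\<beta>} t * q n t) = indicator {\<alpha>..\<beta>} t * d t"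
      using lim AE_pos
    proof eventually_elim
      case (elim t)
      show ?case
        by (cases "t \<in> {\<alpha>..\<beta>}") (use elim ab in \<open>auto simp: q_def intro!: limI\<close>)
    qed
  qed
  have d_meas: "d \<in> borel_measurable \<mu>"
    using d_meas' unfolding \<mu>_def by (simp add: borel_measurable_restrict_space_iff)
  have int_L: "integrable \<mu> (\<lambda>_. L)" unfolding \<mu>_def
    by (simp add: integrable_restrict_space)
  have int_d: "integrable \<mu> d"
    by (rule integrable_dominated_convergence[OF d_meas q_meas int_L lim' bound])
  have conv: "(\<lambda>n. integral\<^sup>L \<mu> (q n)) \<longlonglongrightarrow> integral\<^sup>L \<mu> d"
    by (rule integral_dominated_convergence[OF d_meas q_meas int_L lim' bound])
  define P where "P x = integral {0..x} e" for x
  \<comment> \<open>The interval reaches to \<open>\<beta> + 1\<close> so that the shifted end point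
    \<open>\<beta> + 1 / Suc n\<close> stays inside.\<close>
  have P: "(P has_real_derivative e x) (at x within {0..\<beta> + 1})" if "x \<in> {0..\<beta> + 1}" for x
    unfolding P_def using that
    by (intro integral_has_real_derivative continuous_on_subset[OF cont]) auto
  have int_e: "e integrable_on {x..y}" if "0 \<le> x" for x y
    using that by (intro integrable_continuous_interval continuous_on_subset[OF cont]) auto
  have P_diff: "integral {x..y} e = P y - P x" if "0 \<le> x" "x \<le> y" for x y
    using Henstock_Kurzweil_Integration.integral_combine[of 0 x y e] int_e[of 0 y] that
    by (simp add: P_def)
  have int_q: "integral\<^sup>L \<mu> (q n) =
      (P (\<beta> + 1 / Suc n) - P \<beta>) * Suc n - (P (\<alpha> + 1 / Suc n) - P \<alpha>) * Suc n" for n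
  proof -
    have "integral\<^sup>L \<mu> (q n) = integral {\<alpha>..\<beta>} (q n)"
      unfolding \<mu>_def
      using continuous_imp_integrable_real[OF contq]
      by (intro lebesgue_integral_eq_integral) auto
    also have "\<dots> = (integral {\<alpha>..\<beta>} (\<lambda>t. e (t + 1 / Suc n)) - integral {\<alpha>..\<beta>} e) * Suc n"
      unfolding q_def using ab int_e
      by (subst Henstock_Kurzweil_Integration.integral_mult_left,
          subst Henstock_Kurzweil_Integration.integral_diff)
         (auto intro!: integrable_continuous_interval continuous_on_compose2[OF cont] continuous_intros)
    \<comment> \<open>After this shift, the common part of the two intervals cancels in the
      difference.\<close>
    also have "integral {\<alpha>..\<beta>} (\<lambda>t. e (t + 1 / Suc n)) = integral {\<alpha> + 1 / Suc n..\<beta> + 1 / Suc n} e"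
      using integral_shift[of \<alpha> "1 / Suc n" \<beta> e] ab
      by (simp add: o_def continuous_on_subset[OF cont] del: of_nat_Suc)
    finally show ?thesis using ab by (simp add: P_diff algebra_simps)
  qed
  have dq: "(\<lambda>n. (P (x + 1 / Suc n) - P x) * Suc n) \<longlonglongrightarrow> e x" if "x \<in> {0..\<beta>}" for x
  proof -
    have x: "x \<in> {0..\<beta> + 1}" using that by auto
    have "((\<lambda>y. (P y - P x) / (y - x)) \<longlongrightarrow> e x) (at x within {0..\<beta> + 1})"
      using P[OF x] by (simp add: has_field_derivative_iff)
    moreover have "filterlim (\<lambda>n. x + 1 / Suc n) (at x within {0..\<beta> + 1}) sequentially"
      unfolding filterlim_at
    proof
      show "(\<lambda>n. x + 1 / Suc n) \<longlonglongrightarrow> x"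
        using tendsto_add[OF tendsto_const[of x] LIMSEQ_Suc[OF lim_1_over_n]] by simp
      show "\<forall>\<^sub>F n in sequentially. x + 1 / Suc n \<in> {0..\<beta> + 1} \<and> x + 1 / Suc n \<noteq> x"
        using that by (intro always_eventually allI) (auto intro!: add_mono simp del: of_nat_Suc)
    qed
    ultimately have "(\<lambda>n. (P (x + 1 / Suc n) - P x) / (x + 1 / Suc n - x)) \<longlonglongrightarrow> e x"
      by (rule filterlim_compose)
    then show ?thesis by simp
  qed
  have "(\<lambda>n. integral\<^sup>L \<mu> (q n)) \<longlonglongrightarrow> e \<beta> - e \<alpha>"
    unfolding int_q using ab by (intro tendsto_diff dq) auto
  then have "integral\<^sup>L \<mu> d = e \<beta> - e \<alpha>" using conv LIMSEQ_unique by blast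
  then show "(LINT t:{\<alpha>..\<beta>}|lebesgue. d t) = e \<beta> - e \<alpha>"
    by (simp add: \<mu>_def integral_restrict_space set_lebesgue_integral_def)
  show "set_integrable lebesgue {\<alpha>..\<beta>} d"
    using int_d by (simp add: \<mu>_def integrable_restrict_space set_integrable_def)
qed

section \<open>Square roots of positive semidefinite matrices\<close>

text \<open>The maximiser of the Rayleigh quotient on the compact unit sphere of \<open>S\<close> is
  an eigenvector: its residual \<open>w\<close> is orthogonal to it, and moving along
  \<open>w\<close> would increase the quotient to first order unless \<open>w = 0\<close>.\<close>

lemma symmetric_operator_eigenvector:
  fixes f :: "'a::euclidean_space \<Rightarrow> 'a"
  assumes f: "linear f" and sym: "\<And>x y. f x \<bullet> y = x \<bullet> f y"
    and S: "subspace S" "S \<noteq> {0}" and inv: "\<And>x. x \<in> S \<Longrightarrow> f x \<in> S"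
  obtains e \<mu> where "e \<in> S" "norm e = 1" "f e = \<mu> *\<^sub>R e"
proof -
  obtain z where z: "z \<in> S" "z \<noteq> 0" using S subspace_0 by blast
  have "compact (sphere 0 1 \<inter> S)"
    by (intro compact_Int_closed compact_sphere closed_subspace S)
  moreover have "(1 / norm z) *\<^sub>R z \<in> sphere 0 1 \<inter> S"
    using z S by (auto intro: subspace_scale)
  then have "sphere 0 1 \<inter> S \<noteq> {}" by blast
  moreover have "continuous_on (sphere 0 1 \<inter> S) (\<lambda>x. x \<bullet> f x)"
    by (intro continuous_intros linear_continuous_on linear_conv_bounded_linear[THEN iffD1] f)
  ultimately have "\<exists>e\<in>sphere 0 1 \<inter> S. \<forall>x\<in>sphere 0 1 \<inter> S. x \<bullet> f x \<le> e \<bullet> f e"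
    by (rule continuous_attains_sup)
  then obtain e where e: "e \<in> sphere 0 1 \<inter> S"
    and max: "\<And>x. x \<in> sphere 0 1 \<inter> S \<Longrightarrow> x \<bullet> f x \<le> e \<bullet> f e"
    by blast
  define \<mu> where "\<mu> = e \<bullet> f e"
  have quad: "x \<bullet> f x \<le> \<mu> * (norm x)\<^sup>2" if "x \<in> S" for x
  proof (cases "x = 0")
    case False
    define y where "y = (1 / norm x) *\<^sub>R x"
    have y: "y \<in> sphere 0 1 \<inter> S" using that S False by (auto simp: y_def intro: subspace_scale)
    have "x = norm x *\<^sub>R y" using False by (simp add: y_def)
    then have "x \<bullet> f x = (norm x)\<^sup>2 * (y \<bullet> f y)"
      using linear_scale[OF f, of "norm x" y] by (metis inner_scaleR_left inner_scaleR_right mult.assoc power2_eq_square)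
    also have "\<dots> \<le> (norm x)\<^sup>2 * \<mu>"
      unfolding \<mu>_def by (intro mult_left_mono max y) auto
    finally show ?thesis by (simp add: mult.commute)
  qed (simp add: linear_0[OF f])
  define w where "w = f e - \<mu> *\<^sub>R e"
  have eS: "e \<in> S" "norm e = 1" using e by auto
  then have ee: "e \<bullet> e = 1" by (simp add: dot_square_norm)
  have wS: "w \<in> S" unfolding w_def using eS S inv by (intro subspace_diff subspace_scale)
  have we: "e \<bullet> w = 0" using ee by (simp add: w_def \<mu>_def inner_diff_right)
  have fe: "f e = w + \<mu> *\<^sub>R e" by (simp add: w_def)
  have ew: "w \<bullet> e = 0" using we by (simp add: inner_commute)
  have fw: "e \<bullet> f w = w \<bullet> w"
    using sym[of e w] ew we by (simp add: fe inner_add_left)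
  \<comment> \<open>This is \<open>quad\<close> at \<open>e + t w\<close>: the zeroth-order terms
    cancel and a first-order term is left against a second-order one.\<close>
  have key: "2 * t * (w \<bullet> w) \<le> t\<^sup>2 * (\<mu> * (w \<bullet> w) - w \<bullet> f w)" for t
  proof -
    have "(e + t *\<^sub>R w) \<bullet> f (e + t *\<^sub>R w) = \<mu> + 2 * t * (w \<bullet> w) + t\<^sup>2 * (w \<bullet> f w)"
      using ew we ee
      by (simp add: linear_add[OF f] linear_scale[OF f] inner_add_left inner_add_right fw fe
          power2_eq_square algebra_simps)
    moreover have "(norm (e + t *\<^sub>R w))\<^sup>2 = 1 + t\<^sup>2 * (w \<bullet> w)"
      unfolding power2_norm_eq_inner
      using ew we ee by (simp add: inner_add_left inner_add_right power2_eq_square)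
    moreover have "e + t *\<^sub>R w \<in> S" using eS wS S by (intro subspace_add subspace_scale)
    ultimately show ?thesis using quad[of "e + t *\<^sub>R w"] by (simp add: algebra_simps)
  qed
  have "w \<bullet> w = 0"
  proof (rule ccontr)
    assume "w \<bullet> w \<noteq> 0"
    then have pos: "w \<bullet> w > 0" by simp
    define C where "C = \<bar>\<mu> * (w \<bullet> w) - w \<bullet> f w\<bar> + 1"
    \<comment> \<open>With this \<open>t\<close> the inequality yields
      \<open>2 * t * (w \<bullet> w) \<le> t * (w \<bullet> w)\<close>; the 1 in \<open>C\<close>
      keeps the denominator positive.\<close>
    define t where "t = (w \<bullet> w) / C"
    have C: "C > 0" by (simp add: C_def)
    then have t: "t > 0" using pos by (simp add: t_def)
    have "2 * t * (w \<bullet> w) \<le> t\<^sup>2 * C"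
      using key[of t] mult_left_mono[of "\<mu> * (w \<bullet> w) - w \<bullet> f w" C "t\<^sup>2"]
      by (simp add: C_def abs_ge_self add_increasing2)
    also have "\<dots> = t * (w \<bullet> w)" using C by (simp add: t_def power2_eq_square)
    finally show False using t pos by simp
  qed
  then have "f e = \<mu> *\<^sub>R e" using fe by simp
  then show thesis using that eS by blast
qed

text \<open>An orthonormal family of eigenvectors of greatest cardinality exists by the dimension
  bound. Its orthogonal complement is invariant by symmetry of \<open>f\<close>, so if it were
  nonzero it would contain an eigenvector enlarging the family.\<close>

lemma symmetric_operator_eigenbasis:
  fixes f :: "'a::euclidean_space \<Rightarrow> 'a"
  assumes f: "linear f" and sym: "\<And>x y. f x \<bullet> y = x \<bullet> f y"
  obtains E \<mu> where "finite E" "pairwise orthogonal E" "\<And>e. e \<in> E \<Longrightarrow> norm e = 1"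
    "\<And>e. e \<in> E \<Longrightarrow> f e = \<mu> e *\<^sub>R e" "\<And>x. (\<Sum>e\<in>E. (e \<bullet> x) *\<^sub>R e) = x"
proof -
  define P where "P E \<longleftrightarrow> finite E \<and> pairwise orthogonal E \<and>
      (\<forall>e\<in>E. norm e = 1 \<and> (\<exists>l. f e = l *\<^sub>R e))" for E :: "'a set"
  have bound: "card E \<le> DIM('a)" if "P E" for E
  proof -
    have "independent E" using that by (intro pairwise_orthogonal_independent) (auto simp: P_def)
    then show ?thesis by (rule independent_card_le)
  qed
  have "P {}" by (simp add: P_def)
  then obtain E where E: "P E" and max: "\<And>F. P F \<Longrightarrow> card F \<le> card E"
    using ex_has_greatest_nat[of P "{}" card "DIM('a) + 1"] bound
    by (meson less_add_one less_le_not_le order_le_less_trans)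
  define S where "S = {x. \<forall>e\<in>E. orthogonal e x}"
  have S: "subspace S" unfolding S_def by (rule subspace_orthogonal_to_vectors)
  have S0: "S = {0}"
  proof (rule ccontr)
    assume "S \<noteq> {0}"
    moreover have "f x \<in> S" if "x \<in> S" for x
      unfolding S_def
    proof (safe)
      fix e assume e: "e \<in> E"
      then obtain l where "f e = l *\<^sub>R e" using E by (auto simp: P_def)
      then show "orthogonal e (f x)"
        using that e sym[of e x] by (simp add: S_def orthogonal_def)
    qed
    ultimately obtain e l where e: "e \<in> S" "norm e = 1" "f e = l *\<^sub>R e"
      using symmetric_operator_eigenvector[OF f sym S] by metis
    have "e \<notin> E" using e by (auto simp: S_def orthogonal_def)
    have "P (insert e E)"
      using E e unfolding P_def
      by (auto simp: pairwise_insert S_def orthogonal_commute)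
    then show False using max[of "insert e E"] \<open>e \<notin> E\<close> E by (simp add: P_def)
  qed
  have sum: "(\<Sum>e\<in>E. (e \<bullet> x) *\<^sub>R e) = x" for x
  proof -
    have "x - (\<Sum>e\<in>E. (e \<bullet> x) *\<^sub>R e) \<in> S"
      unfolding S_def
    proof safe
      fix d assume d: "d \<in> E"
      have "d \<bullet> (\<Sum>e\<in>E. (e \<bullet> x) *\<^sub>R e) = (\<Sum>e\<in>E. if e = d then d \<bullet> x else 0)"
        unfolding inner_sum_right
      proof (intro sum.cong refl)
        fix e assume e: "e \<in> E"
        show "d \<bullet> (e \<bullet> x) *\<^sub>R e = (if e = d then d \<bullet> x else 0)"
          using E e d by (auto simp: P_def pairwise_def orthogonal_def dot_square_norm)
      qed
      also have "\<dots> = d \<bullet> x" using E d by (simp add: P_def)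
      finally show "orthogonal d (x - (\<Sum>e\<in>E. (e \<bullet> x) *\<^sub>R e))"
        by (simp add: orthogonal_def inner_diff_right)
    qed
    then show ?thesis using S0 by simp
  qed
  obtain \<mu> where "\<And>e. e \<in> E \<Longrightarrow> f e = \<mu> e *\<^sub>R e"
    using E unfolding P_def by metis
  then show thesis using that[of E \<mu>] E sum by (simp add: P_def)
qed

text \<open>\<open>matrix_sqrt\<close> is a choice, so its defining properties become available once
  a witness exists. The witness multiplies each vector of an eigenbasis by the square root of its
  eigenvalue.\<close>

lemma matrix_square_root_exists:
  fixes A :: "real^'n^'n"
  assumes sym: "transpose A = A" and pos: "\<And>\<xi>. 0 \<le> \<xi> \<bullet> (A *v \<xi>)"
  shows "\<exists>B. transpose B = B \<and> (\<forall>\<xi>. 0 \<le> \<xi> \<bullet> (B *v \<xi>)) \<and> B ** B = A"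
proof -
  have symA: "(A *v x) \<bullet> y = x \<bullet> (A *v y)" for x y
    by (metis dot_lmul_matrix sym transpose_matrix_vector)
  obtain E \<mu> where E: "finite E" "pairwise orthogonal E" "\<And>e. e \<in> E \<Longrightarrow> norm e = 1"
    and eig: "\<And>e. e \<in> E \<Longrightarrow> A *v e = \<mu> e *\<^sub>R e"
    and expand: "\<And>x. (\<Sum>e\<in>E. (e \<bullet> x) *\<^sub>R e) = x"
    by (rule symmetric_operator_eigenbasis[OF matrix_vector_mul_linear[of A] symA]) (rule that)
  have \<mu>_nonneg: "\<mu> e \<ge> 0" if "e \<in> E" for e
    using pos[of e] eig[OF that] E(3)[OF that] by (simp add: dot_square_norm)
  define h where "h x = (\<Sum>e\<in>E. (sqrt (\<mu> e) * (e \<bullet> x)) *\<^sub>R e)" for x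
  have lin: "linear h"
    by (rule linearI) (auto simp: h_def inner_add_right algebra_simps scaleR_sum_right sum.distrib)
  define B where "B = matrix h"
  have B: "B *v x = h x" for x unfolding B_def by (rule fun_cong[OF matrix_vector_mul(2)[OF lin]])
  have sym_h: "h x \<bullet> y = x \<bullet> h y" for x y
    by (simp add: h_def inner_sum_left inner_sum_right inner_commute ac_simps)
  have "transpose B = B"
  proof -
    have "(transpose B *v x) \<bullet> y = (B *v x) \<bullet> y" for x y
      using sym_h by (metis B dot_lmul_matrix transpose_matrix_vector)
    then have "transpose B *v x = B *v x" for x
      by (metis vector_eq_rdot)
    then show ?thesis by (simp add: matrix_eq)
  qed
  moreover have "0 \<le> \<xi> \<bullet> (B *v \<xi>)" for \<xi>
    unfolding B h_def inner_sum_right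
    by (intro sum_nonneg) (simp add: \<mu>_nonneg inner_commute mult.assoc)
  moreover have "B ** B = A"
  proof -
    have inner_h: "d \<bullet> h x = sqrt (\<mu> d) * (d \<bullet> x)" if d: "d \<in> E" for d x
    proof -
      have "d \<bullet> h x = (\<Sum>e\<in>E. if e = d then sqrt (\<mu> d) * (d \<bullet> x) else 0)"
        unfolding h_def inner_sum_right
      proof (intro sum.cong refl)
        fix e assume e: "e \<in> E"
        show "d \<bullet> (sqrt (\<mu> e) * (e \<bullet> x)) *\<^sub>R e = (if e = d then sqrt (\<mu> d) * (d \<bullet> x) else 0)"
          using E e d by (auto simp: pairwise_def orthogonal_def dot_square_norm)
      qed
      then show ?thesis using E d by simp
    qed
    have "B ** B *v x = A *v x" for x
    proof -
      have "B ** B *v x = h (h x)" by (simp add: B flip: matrix_vector_mul_assoc)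
      also have "\<dots> = (\<Sum>e\<in>E. (\<mu> e * (e \<bullet> x)) *\<^sub>R e)"
        unfolding h_def[of "h x"]
        by (intro sum.cong refl) (simp add: inner_h \<mu>_nonneg flip: mult.assoc)
      also have "\<dots> = A *v (\<Sum>e\<in>E. (e \<bullet> x) *\<^sub>R e)"
        by (simp add: linear_sum[OF matrix_vector_mul_linear] linear_scale[OF matrix_vector_mul_linear] eig mult.commute)
      finally show ?thesis using expand by simp
    qed
    then show ?thesis by (simp add: matrix_eq)
  qed
  ultimately show ?thesis by blast
qed

section \<open>Smooth functions and the fundamental lemma of the calculus of variations\<close>

lemma frechet_derivative_eqI:
  "(f has_derivative f') (at x) \<Longrightarrow> frechet_derivative f (at x) = f'"
  using frechet_derivative_at by metis

text \<open>The clause for \<open>Suc k\<close> speaks of \<open>f\<close> itself only through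
  differentiability, so the lower orders are recovered by induction. The product rule relies on
  this, since undifferentiated factors appear in it.\<close>

lemma Ck_on_SucD:
  "Ck_on (Suc k) UNIV f \<Longrightarrow> Ck_on k UNIV f"
proof (induction k arbitrary: f)
  case 0
  then have "continuous (at x) f" for x
    by (simp add: differentiable_imp_continuous_within)
  then show ?case by (simp add: continuous_at_imp_continuous_on)
next
  case (Suc k)
  then show ?case by (metis Ck_on.simps(2))
qed

lemma Ck_on_const: "Ck_on k UNIV (\<lambda>x. c)"
  by (induction k arbitrary: c) (auto simp: frechet_derivative_const)

lemma Ck_on_add:
  assumes "Ck_on k UNIV f" "Ck_on k UNIV g"
  shows "Ck_on k UNIV (\<lambda>x. f x + g x)"
  using assms
proof (induction k arbitrary: f g)
  case (Suc k)
  have der: "((\<lambda>x. f x + g x) has_derivative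
      (\<lambda>v. frechet_derivative f (at x) v + frechet_derivative g (at x) v)) (at x)" for x
    using Suc.prems by (intro has_derivative_add) (auto simp: frechet_derivative_works[symmetric])
  show ?case using Suc by (auto intro: differentiable_add simp: frechet_derivative_eqI[OF der])
qed (auto intro: continuous_on_add)

lemma Ck_on_bounded_linear:
  assumes "bounded_linear L" "Ck_on k UNIV f"
  shows "Ck_on k UNIV (\<lambda>x. L (f x))"
  using assms(2)
proof (induction k arbitrary: f)
  case 0
  then show ?case using assms(1) by (auto intro: bounded_linear.continuous_on)
next
  case (Suc k)
  have der: "((\<lambda>x. L (f x)) has_derivative (\<lambda>v. L (frechet_derivative f (at x) v))) (at x)" for x
    using Suc.prems
    by (intro bounded_linear.has_derivative[OF assms(1)]) (simp add: frechet_derivative_works[symmetric])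
  have "(\<lambda>x. L (f x)) differentiable (at x)" for x
    using der differentiable_def by blast
  then show ?case using Suc by (simp add: frechet_derivative_eqI[OF der])
qed

lemma Ck_on_mult:
  fixes f g :: "'a::real_normed_vector \<Rightarrow> real"
  assumes "Ck_on k UNIV f" "Ck_on k UNIV g"
  shows "Ck_on k UNIV (\<lambda>x. f x * g x)"
  using assms
proof (induction k arbitrary: f g)
  case (Suc k)
  have der: "((\<lambda>x. f x * g x) has_derivative
      (\<lambda>v. f x * frechet_derivative g (at x) v + frechet_derivative f (at x) v * g x)) (at x)" for x
    using Suc.prems by (intro has_derivative_mult) (auto simp: frechet_derivative_works[symmetric])
  have "(\<lambda>x. f x * g x) differentiable (at x)" for x
    using der differentiable_def by blast
  moreover have "Ck_on k UNIV
      (\<lambda>x. f x * frechet_derivative g (at x) v + frechet_derivative f (at x) v * g x)" for v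
    using Suc.prems Ck_on_SucD[OF Suc.prems(1)] Ck_on_SucD[OF Suc.prems(2)]
    by (intro Ck_on_add Suc.IH) auto
  ultimately show ?case by (simp add: frechet_derivative_eqI[OF der])
qed (auto intro: continuous_on_mult)

lemma Ck_on_prod:
  fixes f :: "'i \<Rightarrow> 'a::real_normed_vector \<Rightarrow> real"
  assumes "finite I" "\<And>i. i \<in> I \<Longrightarrow> Ck_on k UNIV (f i)"
  shows "Ck_on k UNIV (\<lambda>x. \<Prod>i\<in>I. f i x)"
  using assms by (induction I) (auto intro: Ck_on_const Ck_on_mult)

lemma Ck_on_power:
  fixes f :: "'a::real_normed_vector \<Rightarrow> real"
  assumes "Ck_on k UNIV f"
  shows "Ck_on k UNIV (\<lambda>x. f x ^ n)"
  using assms by (induction n) (auto intro: Ck_on_const Ck_on_mult)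

lemma Ck_on_diff:
  fixes f g :: "'a::real_normed_vector \<Rightarrow> real"
  assumes "Ck_on k UNIV f" "Ck_on k UNIV g"
  shows "Ck_on k UNIV (\<lambda>x. f x - g x)"
  using Ck_on_add[OF assms(1) Ck_on_bounded_linear[OF bounded_linear_minus[OF bounded_linear_ident] assms(2)]]
  by simp

text \<open>The powers of \<open>inverse y\<close> make the family closed under differentiation.\<close>

definition flat_exp :: "nat \<Rightarrow> real \<Rightarrow> real" where
  "flat_exp m y = (if y > 0 then exp (- inverse y) * inverse y ^ m else 0)"

lemma flat_exp_tendsto_0: "(flat_exp m \<longlongrightarrow> 0) (at 0)"
proof (rule filterlim_split_at)
  show "(flat_exp m \<longlongrightarrow> 0) (at_left 0)"
    by (rule tendsto_eventually) (auto simp: flat_exp_def eventually_at_left_field intro: exI[of _ "-1"])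
  have "((\<lambda>y. inverse y ^ m / exp (inverse y)) \<longlongrightarrow> 0) (at_right (0::real))"
    by (rule filterlim_compose[OF tendsto_power_div_exp_0 filterlim_inverse_at_top_right])
  moreover have "\<forall>\<^sub>F y in at_right 0. inverse y ^ m / exp (inverse y) = flat_exp m y"
    by (auto simp: flat_exp_def eventually_at_right_field exp_minus divide_inverse intro: exI[of _ 1])
  ultimately show "(flat_exp m \<longlongrightarrow> 0) (at_right 0)"
    by (rule Lim_transform_eventually)
qed

lemma flat_exp_has_field_derivative:
  "(flat_exp m has_field_derivative (flat_exp (m + 2) y - m * flat_exp (m + 1) y)) (at y)"
proof -
  consider "y > 0" | "y < 0" | "y = 0" by linarith
  then show ?thesis
  proof cases
    case 1
    have "((\<lambda>y. exp (- inverse y) * inverse y ^ m) has_field_derivative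
        exp (- inverse y) * (inverse y)\<^sup>2 * inverse y ^ m
        - exp (- inverse y) * (m * inverse y ^ (m - 1) * (inverse y)\<^sup>2)) (at y)"
      using 1 by (auto intro!: derivative_eq_intros simp: power2_eq_square)
    \<comment> \<open>For \<open>m = 0\<close> the exponent \<open>m - 1\<close> is truncated to 0,
      but the factor \<open>m\<close> removes the term.\<close>
    also have "exp (- inverse y) * (inverse y)\<^sup>2 * inverse y ^ m
        - exp (- inverse y) * (m * inverse y ^ (m - 1) * (inverse y)\<^sup>2)
        = flat_exp (m + 2) y - m * flat_exp (m + 1) y"
      using 1 by (cases m) (auto simp: flat_exp_def power2_eq_square)
    finally have "((\<lambda>y. exp (- inverse y) * inverse y ^ m) has_field_derivative
        (flat_exp (m + 2) y - m * flat_exp (m + 1) y)) (at y)" .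
    then show ?thesis
      by (rule has_field_derivative_transform_within_open[of _ _ _ "{0<..}"])
         (use 1 in \<open>auto simp: flat_exp_def\<close>)
  next
    case 2
    have "((\<lambda>y. 0) has_field_derivative (flat_exp (m + 2) y - m * flat_exp (m + 1) y)) (at y)"
      using 2 by (simp add: flat_exp_def)
    then show ?thesis
      by (rule has_field_derivative_transform_within_open[of _ _ _ "{..<0}"])
         (use 2 in \<open>auto simp: flat_exp_def\<close>)
  next
    case 3
    \<comment> \<open>At 0 the difference quotient of \<open>flat_exp m\<close> is
      \<open>flat_exp (Suc m)\<close>, because \<open>flat_exp m 0 = 0\<close>.\<close>
    have "((\<lambda>h. (flat_exp m h - flat_exp m 0) / (h - 0)) \<longlongrightarrow> 0) (at 0)"
      by (rule Lim_transform_eventually[OF flat_exp_tendsto_0[of "Suc m"]])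
         (auto simp: flat_exp_def divide_inverse)
    then show ?thesis using 3 by (simp add: has_field_derivative_iff flat_exp_def)
  qed
qed

text \<open>Affine arguments cover both kinds of face of a box, \<open>x $ i - a $ i\<close> and
  \<open>b $ i - x $ i\<close>.\<close>

lemma Ck_on_flat_exp:
  fixes l :: "'a::real_normed_vector \<Rightarrow> real"
  assumes l: "bounded_linear l"
  shows "Ck_on k UNIV (\<lambda>x. flat_exp m (l x + \<beta>))"
proof (induction k arbitrary: m)
  case 0
  have "continuous (at y) (flat_exp m)" for y
    using flat_exp_has_field_derivative DERIV_isCont by blast
  then have "continuous_on UNIV (flat_exp m)"
    by (simp add: continuous_at_imp_continuous_on)
  then show ?case
    by (auto intro!: continuous_on_compose2[of UNIV "flat_exp m"] continuous_intros
        bounded_linear.continuous_on[OF l])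
next
  case (Suc k)
  have der: "((\<lambda>x. flat_exp m (l x + \<beta>)) has_derivative
      (\<lambda>v. l v * (flat_exp (m + 2) (l x + \<beta>) - m * flat_exp (m + 1) (l x + \<beta>)))) (at x)" for x
  proof -
    have "((\<lambda>x. l x + \<beta>) has_derivative l) (at x)"
      using has_derivative_add_const[OF bounded_linear.has_derivative[OF l has_derivative_ident]] by simp
    from has_derivative_compose[OF this flat_exp_has_field_derivative[unfolded has_field_derivative_def]]
    show ?thesis by (simp add: mult.commute)
  qed
  have "(\<lambda>x. flat_exp m (l x + \<beta>)) differentiable (at x)" for x
    using der differentiable_def by blast
  then show ?case
    by (auto simp: frechet_derivative_eqI[OF der]
        intro!: Ck_on_mult Ck_on_diff Ck_on_const Suc)
qed

text \<open>A product of flat functions, one per face, is smooth and positive exactly on the box.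
  High powers of its complement to 1 tend to 0 inside and stay 1 outside, which gives pointwise
  convergence with a bound fit for dominated convergence.\<close>

lemma smooth_approximation_of_box:
  fixes a b :: "real^'n"
  obtains \<phi> :: "nat \<Rightarrow> real^'n \<Rightarrow> real"
  where "\<And>n k. Ck_on k UNIV (\<phi> n)" "\<And>n x. x \<notin> box a b \<Longrightarrow> \<phi> n x = 0"
    "\<And>n x. \<bar>\<phi> n x\<bar> \<le> 1" "\<And>x. (\<lambda>n. \<phi> n x) \<longlonglongrightarrow> indicator (box a b) x"
proof -
  define \<theta> where "\<theta> x = (\<Prod>i\<in>UNIV. flat_exp 0 (x $ i - a $ i) * flat_exp 0 (b $ i - x $ i))" for x
  define \<phi> where "\<phi> n x = 1 - (1 - \<theta> x) ^ n" for n x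
  have fe: "0 \<le> flat_exp 0 y" "flat_exp 0 y \<le> 1" "flat_exp 0 y > 0 \<longleftrightarrow> y > 0" for y
    by (auto simp: flat_exp_def)
  have \<theta>: "0 \<le> \<theta> x" "\<theta> x \<le> 1" for x
    unfolding \<theta>_def by (auto intro!: prod_nonneg prod_le_1 mult_le_one simp: fe)
  have \<theta>_pos: "\<theta> x > 0" if "x \<in> box a b" for x
    unfolding \<theta>_def using that by (intro prod_pos mult_pos_pos) (auto simp: fe mem_box_cart)
  have \<theta>_0: "\<theta> x = 0" if "x \<notin> box a b" for x
  proof -
    have "\<not> (\<forall>i. a $ i < x $ i \<and> x $ i < b $ i)"
      using that by (simp add: mem_box_cart)
    then obtain i where i: "\<not> (a $ i < x $ i \<and> x $ i < b $ i)" by blast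
    have "flat_exp 0 y = 0" if "y \<le> 0" for y
      using that by (simp add: flat_exp_def)
    then have "flat_exp 0 (x $ i - a $ i) * flat_exp 0 (b $ i - x $ i) = 0"
      using i by (cases "a $ i < x $ i") auto
    then have "\<exists>i\<in>UNIV. flat_exp 0 (x $ i - a $ i) * flat_exp 0 (b $ i - x $ i) = 0"
      by blast
    then show ?thesis
      unfolding \<theta>_def by (intro prod_zero) simp_all
  qed
  have "Ck_on k UNIV \<theta>" for k
    unfolding \<theta>_def
  proof (intro Ck_on_prod Ck_on_mult)
    fix i
    show "Ck_on k UNIV (\<lambda>x. flat_exp 0 (x $ i - a $ i))"
      using Ck_on_flat_exp[OF bounded_linear_vec_nth, of k 0 i "- a $ i"] by simp
    show "Ck_on k UNIV (\<lambda>x. flat_exp 0 (b $ i - x $ i))"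
      using Ck_on_flat_exp[OF bounded_linear_minus[OF bounded_linear_vec_nth], of k 0 i "b $ i"]
      by simp
  qed simp
  then have 1: "Ck_on k UNIV (\<phi> n)" for n k
    unfolding \<phi>_def by (intro Ck_on_diff Ck_on_power Ck_on_const)
  have 2: "\<phi> n x = 0" if "x \<notin> box a b" for n x
    using \<theta>_0[OF that] by (simp add: \<phi>_def)
  have 3: "\<bar>\<phi> n x\<bar> \<le> 1" for n x
    using power_le_one[of "1 - \<theta> x" n] zero_le_power[of "1 - \<theta> x" n] \<theta>[of x] by (simp add: \<phi>_def)
  have 4: "(\<lambda>n. \<phi> n x) \<longlonglongrightarrow> indicator (box a b) x" for x
  proof (cases "x \<in> box a b")
    case True
    have "(\<lambda>n. 1 - (1 - \<theta> x) ^ n) \<longlonglongrightarrow> 1 - 0"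
      using \<theta>[of x] \<theta>_pos[OF True] by (intro tendsto_diff tendsto_const LIMSEQ_power_zero) simp
    then show ?thesis using True by (simp add: \<phi>_def)
  qed (simp add: 2)
  show thesis by (rule that[of \<phi>]) (fact 1 2 3 4)+
qed

section \<open>Cauchy-Schwarz from nonnegative quadratics\<close>

text \<open>Stated for bare coefficients so that it serves both the L2 product and the energy form.
  Neither is definite on functions, as functions vanishing almost everywhere have square 0, so the
  case \<open>B = 0\<close> does occur.\<close>

lemma quadratic_nonneg_imp_square_le:
  fixes A B x :: real
  assumes "\<And>t. 0 \<le> A + 2 * t * x + t\<^sup>2 * B" and "B \<ge> 0"
  shows "x\<^sup>2 \<le> A * B"
proof (cases "B = 0")
  case True
  have "x = 0"
  proof (rule ccontr)
    assume "x \<noteq> 0"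
    \<comment> \<open>This \<open>t\<close> makes the affine expression equal to -1.\<close>
    then show False using assms(1)[of "- (A + 1) / (2 * x)"] True by (simp add: field_simps)
  qed
  then show ?thesis using True by simp
next
  case False
  then have B: "B > 0" using assms(2) by simp
  have "0 \<le> A + 2 * (- (x / B)) * x + (- (x / B))\<^sup>2 * B" by (rule assms(1))
  also have "\<dots> = A - x\<^sup>2 / B" using B by (simp add: power2_eq_square)
  finally show ?thesis using B by (simp add: field_simps)
qed

lemma integrable_mult_of_squares:
  fixes f g :: "'a \<Rightarrow> real"
  assumes "f \<in> borel_measurable N" "integrable N (\<lambda>x. (f x)\<^sup>2)"
    and "g \<in> borel_measurable N" "integrable N (\<lambda>x. (g x)\<^sup>2)"
  shows "integrable N (\<lambda>x. f x * g x)"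
proof (rule Bochner_Integration.integrable_bound)
  show "integrable N (\<lambda>x. (f x)\<^sup>2 + (g x)\<^sup>2)" using assms by simp
  show "AE x in N. norm (f x * g x) \<le> norm ((f x)\<^sup>2 + (g x)\<^sup>2)"
  proof (intro AE_I2)
    fix x
    have "2 * (\<bar>f x\<bar> * \<bar>g x\<bar>) \<le> (f x)\<^sup>2 + (g x)\<^sup>2"
      using sum_squares_bound[of "\<bar>f x\<bar>" "\<bar>g x\<bar>"] by simp
    moreover have "0 \<le> \<bar>f x\<bar> * \<bar>g x\<bar>" by simp
    ultimately show "norm (f x * g x) \<le> norm ((f x)\<^sup>2 + (g x)\<^sup>2)"
      unfolding real_norm_def abs_mult by linarith
  qed
qed (use assms in measurable)

text \<open>Boxes are stable under intersection and generate the Borel sets, so the vanishing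
  spreads to all Borel sets; \<open>UNIV0\<close> carries the passage to complements.\<close>

lemma AE_eq_0_of_box_integrals:
  fixes h :: "'a::euclidean_space \<Rightarrow> real"
  assumes h: "integrable lborel h"
    and UNIV0: "integral\<^sup>L lborel h = 0"
    and box0: "\<And>a b. (LINT x:box a b|lborel. h x) = 0"
  shows "AE x in lborel. h x = 0"
proof -
  have *: "(LINT x:A|lborel. h x) = 0" if "A \<in> sets borel" for A
  proof -
    have seti: "set_integrable lborel A h" if "A \<in> sets borel" for A
      unfolding set_integrable_def using h that by (intro integrable_mult_indicator) auto
    have "Int_stable (range (\<lambda>(a, b). box a b :: 'a set))"
    proof (rule Int_stableI)
      fix S T assume "S \<in> range (\<lambda>(a, b). box a b :: 'a set)" "T \<in> range (\<lambda>(a, b). box a b :: 'a set)"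
      then obtain a b c d where "S = box a b" "T = box c d" by auto
      then have "S \<inter> T = (\<lambda>(a, b). box a b)
          (\<Sum>i\<in>Basis. max (a \<bullet> i) (c \<bullet> i) *\<^sub>R i, \<Sum>i\<in>Basis. min (b \<bullet> i) (d \<bullet> i) *\<^sub>R i)"
        by (simp add: box_Int_box)
      then show "S \<inter> T \<in> range (\<lambda>(a, b). box a b :: 'a set)" by (rule range_eqI)
    qed
    moreover have "range (\<lambda>(a, b). box a b :: 'a set) \<subseteq> Pow UNIV" by simp
    moreover have "A \<in> sigma_sets UNIV (range (\<lambda>(a, b). box a b))"
      using that by (simp add: borel_eq_box)
    ultimately show ?thesis
    proof (induction rule: sigma_sets_induct_disjoint)
      case (basic A) then show ?case using box0 by auto
    next
      case empty then show ?case by (simp add: set_lebesgue_integral_def)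
    next
      case (compl A)
      then have A: "A \<in> sets borel" by (simp add: borel_eq_box)
      have "(LINT x:UNIV|lborel. h x) = (LINT x:A|lborel. h x) + (LINT x:UNIV - A|lborel. h x)"
        using A seti set_integral_Un[of A "UNIV - A" lborel h] by simp
      then show ?case using compl UNIV0 by (simp add: set_lebesgue_integral_def)
    next
      case (union A)
      then have A: "A i \<in> sets borel" for i by (auto simp: borel_eq_box)
      have "(LINT x:(\<Union>i. A i)|lborel. h x) = (\<Sum>i. LINT x:A i|lborel. h x)"
        using A union by (intro lebesgue_integral_countable_add seti) (auto simp: disjoint_family_on_def)
      then show ?case using union by simp
    qed
  qed
  show ?thesis
    by (rule density_unique_real[OF h]) (use * in \<open>auto simp: set_lebesgue_integral_def\<close>)
qed

lemma lebesgue_box: "box a b \<in> sets lebesgue"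
  by (intro sets_completionI_sets) simp

text \<open>The induction over generators lives on Borel sets, so \<open>h\<close> is exchanged for
  a Borel representative \<open>h'\<close>.\<close>

lemma AE_eq_0_of_box_integrals_lebesgue:
  fixes h :: "'a::euclidean_space \<Rightarrow> real"
  assumes h: "integrable lebesgue h"
    and UNIV0: "integral\<^sup>L lebesgue h = 0"
    and box0: "\<And>a b. (LINT x:box a b|lebesgue. h x) = 0"
  shows "AE x in lebesgue. h x = 0"
proof -
  obtain h' where h': "h' \<in> borel_measurable lborel" and eq: "AE x in lborel. h x = h' x"
    using completion_ex_borel_measurable_real[of h lborel] h by auto
  have eq': "AE x in lebesgue. h x = h' x" using eq by (rule AE_completion)
  have h'm: "h' \<in> borel_measurable lebesgue" using h' by (rule measurable_completion)
  have "integrable lebesgue h'"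
    by (rule integrable_cong_AE_imp[OF h h'm]) (use eq' in eventually_elim, simp)
  then have "integrable lborel h'" using h' by (simp add: integrable_completion)
  moreover have "integral\<^sup>L lborel h' = 0"
    using integral_cong_AE[OF _ h'm eq'] h UNIV0 h' by (simp add: integral_completion)
  moreover have "(LINT x:box a b|lborel. h' x) = 0" for a b
  proof -
    have "(LINT x:box a b|lborel. h' x) = (LINT x:box a b|lebesgue. h' x)"
      unfolding set_lebesgue_integral_def using h' by (subst integral_completion) auto
    also have "\<dots> = (LINT x:box a b|lebesgue. h x)"
      unfolding set_lebesgue_integral_def
      using h h'm eq' lebesgue_box
      by (intro integral_cong_AE) (auto intro!: borel_measurable_times borel_measurable_indicator)
    finally show ?thesis using box0 by simp
  qed
  ultimately have "AE x in lborel. h' x = 0" by (rule AE_eq_0_of_box_integrals)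
  then have "AE x in lebesgue. h' x = 0" by (rule AE_completion)
  then show ?thesis using eq' by eventually_elim simp
qed

section \<open>Square-integrable functions on a bounded open set\<close>

locale bounded_domain =
  fixes \<Omega> :: "(real^'n) set"
  assumes open_domain: "open \<Omega>" and bounded_domain: "bounded \<Omega>"
begin

abbreviation \<open>dx \<equiv> lebesgue_on \<Omega>\<close>

lemma domain_sets [simp, measurable]: "\<Omega> \<in> sets lebesgue"
  using open_domain by (intro sets_completionI_sets) simp

lemma finite_measure_dx: "finite_measure dx"
  by (rule finite_measure_lebesgue_on) (simp add: bounded_set_imp_lmeasurable bounded_domain)

lemma LINT_dx: "(LINT x:\<Omega>|lebesgue. f x) = integral\<^sup>L dx f"
  for f :: "real^'n \<Rightarrow> real"
  by (simp add: set_lebesgue_integral_def integral_restrict_space)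

lemma AE_dx: "(AE x in dx. P x) \<longleftrightarrow> (AE x in lebesgue. x \<in> \<Omega> \<longrightarrow> P x)"
  by (simp add: AE_restrict_space_iff)

lemma mem_L2_iff: "f \<in> L2 \<Omega> \<longleftrightarrow> f \<in> borel_measurable dx \<and> integrable dx (\<lambda>x. (f x)\<^sup>2)"
  by (simp add: L2_def set_borel_measurable_def set_integrable_def integrable_restrict_space
      borel_measurable_restrict_space_iff mult.commute)

lemma L2_borel_measurable: "f \<in> L2 \<Omega> \<Longrightarrow> f \<in> borel_measurable dx"
  by (simp add: mem_L2_iff)

lemma L2_norm_nonneg: "L2_norm \<Omega> f \<ge> 0"
  by (simp add: L2_norm_def LINT_dx)

lemma L2_norm_square: "(L2_norm \<Omega> f)\<^sup>2 = (\<integral>x. (f x)\<^sup>2 \<partial>dx)"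
  by (simp add: L2_norm_def LINT_dx)

lemma L2_mult_integrable: "f \<in> L2 \<Omega> \<Longrightarrow> g \<in> L2 \<Omega> \<Longrightarrow> integrable dx (\<lambda>x. f x * g x)"
  by (simp add: mem_L2_iff integrable_mult_of_squares)

lemma L2_bounded: "f \<in> borel_measurable dx \<Longrightarrow> (\<And>x. x \<in> \<Omega> \<Longrightarrow> \<bar>f x\<bar> \<le> K) \<Longrightarrow> f \<in> L2 \<Omega>"
  unfolding mem_L2_iff
proof
  assume f: "f \<in> borel_measurable dx" and K: "\<And>x. x \<in> \<Omega> \<Longrightarrow> \<bar>f x\<bar> \<le> K"
  show "integrable dx (\<lambda>x. (f x)\<^sup>2)"
  proof (rule finite_measure.integrable_const_bound[OF finite_measure_dx])
    show "AE x in dx. norm ((f x)\<^sup>2) \<le> K\<^sup>2"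
      by (rule AE_I2) (use K in \<open>simp add: abs_le_square_iff[symmetric], force\<close>)
  qed (use f in measurable)
qed

lemma L2_mult_bounded:
  assumes f: "f \<in> L2 \<Omega>" and m: "m \<in> borel_measurable dx" "\<And>x. x \<in> \<Omega> \<Longrightarrow> \<bar>m x\<bar> \<le> K"
  shows "(\<lambda>x. m x * f x) \<in> L2 \<Omega>"
  unfolding mem_L2_iff
proof
  show "(\<lambda>x. m x * f x) \<in> borel_measurable dx" using f m by (auto simp: mem_L2_iff)
  show "integrable dx (\<lambda>x. (m x * f x)\<^sup>2)"
  proof (rule Bochner_Integration.integrable_bound)
    show "integrable dx (\<lambda>x. K\<^sup>2 * (f x)\<^sup>2)" using f by (simp add: mem_L2_iff)
    show "AE x in dx. norm ((m x * f x)\<^sup>2) \<le> norm (K\<^sup>2 * (f x)\<^sup>2)"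
    proof (rule AE_I2)
      fix x assume "x \<in> space dx"
      then have "\<bar>m x\<bar> \<le> K" using m by simp
      then have "(m x)\<^sup>2 \<le> K\<^sup>2" using abs_le_square_iff[of "m x" K] by simp
      then show "norm ((m x * f x)\<^sup>2) \<le> norm (K\<^sup>2 * (f x)\<^sup>2)"
        by (simp add: power_mult_distrib mult_right_mono)
    qed
  qed (use f m in \<open>auto simp: mem_L2_iff\<close>)
qed

lemma L2_add:
  assumes f: "f \<in> L2 \<Omega>" and g: "g \<in> L2 \<Omega>"
  shows "(\<lambda>x. f x + g x) \<in> L2 \<Omega>"
proof -
  have "integrable dx (\<lambda>x. (f x)\<^sup>2 + (g x)\<^sup>2 + 2 * (f x * g x))"
    using f g L2_mult_integrable[OF f g] by (simp add: mem_L2_iff)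
  then show ?thesis using f g by (auto simp: mem_L2_iff power2_sum mult.assoc)
qed

lemma L2_cmult: "f \<in> L2 \<Omega> \<Longrightarrow> (\<lambda>x. c * f x) \<in> L2 \<Omega>"
  by (rule L2_mult_bounded[of f "\<lambda>_. c" "\<bar>c\<bar>"]) auto

lemma L2_diff: "f \<in> L2 \<Omega> \<Longrightarrow> g \<in> L2 \<Omega> \<Longrightarrow> (\<lambda>x. f x - g x) \<in> L2 \<Omega>"
  using L2_add[of f "\<lambda>x. (-1) * g x"] L2_cmult[of g "-1"] by simp

lemma L2_sum: "(\<And>i. i \<in> I \<Longrightarrow> f i \<in> L2 \<Omega>) \<Longrightarrow> (\<lambda>x. \<Sum>i\<in>I. f i x) \<in> L2 \<Omega>"
proof (induction I rule: infinite_finite_induct)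
  case (insert i I)
  then show ?case by (simp add: L2_add)
qed (auto intro!: L2_bounded[of _ 0])

lemma L2_integrable: "f \<in> L2 \<Omega> \<Longrightarrow> integrable dx f"
  using L2_mult_integrable[of f "\<lambda>_. 1"] L2_bounded[of "\<lambda>_. 1" 1] by simp

lemma L2_Cauchy_Schwarz:
  assumes f: "f \<in> L2 \<Omega>" and g: "g \<in> L2 \<Omega>"
  shows "\<bar>\<integral>x. f x * g x \<partial>dx\<bar> \<le> L2_norm \<Omega> f * L2_norm \<Omega> g"
proof -
  have fg: "integrable dx (\<lambda>x. (f x)\<^sup>2)" "integrable dx (\<lambda>x. (g x)\<^sup>2)"
    using f g by (auto simp: mem_L2_iff)
  have "(\<integral>x. f x * g x \<partial>dx)\<^sup>2 \<le> (\<integral>x. (f x)\<^sup>2 \<partial>dx) * (\<integral>x. (g x)\<^sup>2 \<partial>dx)"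
  proof (rule quadratic_nonneg_imp_square_le)
    fix t
    have "0 \<le> (\<integral>x. (f x + t * g x)\<^sup>2 \<partial>dx)" by simp
    also have "(\<lambda>x. (f x + t * g x)\<^sup>2) = (\<lambda>x. (f x)\<^sup>2 + 2 * t * (f x * g x) + t\<^sup>2 * (g x)\<^sup>2)"
      by (auto simp: power2_eq_square algebra_simps)
    finally show "0 \<le> (\<integral>x. (f x)\<^sup>2 \<partial>dx) + 2 * t * (\<integral>x. f x * g x \<partial>dx) + t\<^sup>2 * (\<integral>x. (g x)\<^sup>2 \<partial>dx)"
      using fg L2_mult_integrable[OF f g] by simp
  qed simp
  also have "\<dots> = (L2_norm \<Omega> f * L2_norm \<Omega> g)\<^sup>2" by (simp add: power_mult_distrib L2_norm_square)
  finally show ?thesis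
    using L2_norm_nonneg abs_le_square_iff[of _ "L2_norm \<Omega> f * L2_norm \<Omega> g"] by simp
qed

text \<open>Test functions approximate indicators of boxes inside the domain, so \<open>w\<close>
  integrates to 0 over such boxes. Cutting \<open>w\<close> off to one box reduces to the box
  criterion, and countably many boxes cover the domain.\<close>

lemma fundamental_lemma_of_variations:
  assumes w: "w \<in> L2 \<Omega>"
    and zero: "\<And>\<phi>. \<phi> \<in> test_functions \<Omega> \<Longrightarrow> (\<integral>x. w x * \<phi> x \<partial>dx) = 0"
  shows "AE x in dx. w x = 0"
proof -
  have int_w: "integrable dx w" using w by (rule L2_integrable)
  \<comment> \<open>The closed box must lie in the domain because it serves as the compact support
    of the test functions.\<close>
  have box0: "(\<integral>x. w x * indicator (box a b) x \<partial>dx) = 0" if ab: "cbox a b \<subseteq> \<Omega>" for a b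
  proof -
    obtain \<phi> :: "nat \<Rightarrow> real^'n \<Rightarrow> real" where \<phi>: "\<And>n k. Ck_on k UNIV (\<phi> n)"
      "\<And>n x. x \<notin> box a b \<Longrightarrow> \<phi> n x = 0" "\<And>n x. \<bar>\<phi> n x\<bar> \<le> 1"
      "\<And>x. (\<lambda>n. \<phi> n x) \<longlonglongrightarrow> indicator (box a b) x"
      using smooth_approximation_of_box[of a b] by metis
    have test: "\<phi> n \<in> test_functions \<Omega>" for n
    proof -
      have "\<forall>x. x \<notin> cbox a b \<longrightarrow> \<phi> n x = 0" using \<phi>(2) box_subset_cbox[of a b] by blast
      then show ?thesis
        using ab \<phi>(1) unfolding test_functions_def by (auto intro!: exI[of _ "cbox a b"])
    qed
    have meas: "\<phi> n \<in> borel_measurable dx" for n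
    proof -
      have "continuous_on UNIV (\<phi> n)" using \<phi>(1)[of 0 n] by simp
      then have "\<phi> n \<in> borel_measurable borel" by (rule borel_measurable_continuous_onI)
      then have "\<phi> n \<in> borel_measurable lebesgue" by (simp add: measurable_completion)
      then show ?thesis by (rule measurable_restrict_space1)
    qed
    have "(\<lambda>n. \<integral>x. w x * \<phi> n x \<partial>dx) \<longlonglongrightarrow> (\<integral>x. w x * indicator (box a b) x \<partial>dx)"
    proof (rule integral_dominated_convergence)
      show "integrable dx (\<lambda>x. \<bar>w x\<bar>)" using int_w by simp
      show "AE x in dx. (\<lambda>n. w x * \<phi> n x) \<longlonglongrightarrow> w x * indicator (box a b) x"
        by (intro AE_I2 tendsto_mult tendsto_const \<phi>)
      show "AE x in dx. norm (w x * \<phi> n x) \<le> \<bar>w x\<bar>" for n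
        using \<phi>(3) by (intro AE_I2) (simp add: abs_mult mult_left_le)
      show "(\<lambda>x. w x * \<phi> n x) \<in> borel_measurable dx" for n
        using meas w by (auto simp: mem_L2_iff)
      have "(indicator (box a b) :: _ \<Rightarrow> real) \<in> borel_measurable lebesgue"
        using lebesgue_box by (rule borel_measurable_indicator)
      then have "(indicator (box a b) :: _ \<Rightarrow> real) \<in> borel_measurable dx"
        by (rule measurable_restrict_space1)
      then show "(\<lambda>x. w x * indicator (box a b) x) \<in> borel_measurable dx"
        using w by (auto simp: mem_L2_iff)
    qed
    then show ?thesis using zero[OF test] by (simp add: LIMSEQ_const_iff)
  qed
  have local: "AE x in lebesgue. x \<in> cbox a b \<longrightarrow> w x = 0" if ab: "cbox a b \<subseteq> \<Omega>" for a b
  proof -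
    define h where "h x = indicator (box a b) x * w x" for x
    have box_sub: "box a b \<subseteq> \<Omega>" using ab box_subset_cbox by blast
    have hO: "h x = indicator \<Omega> x *\<^sub>R h x" for x
      using box_sub by (auto simp: h_def indicator_def)
    have int_h: "integrable lebesgue h"
    proof -
      have "integrable lebesgue (\<lambda>x. indicator \<Omega> x *\<^sub>R w x)"
        using int_w by (simp add: integrable_restrict_space)
      then have "integrable lebesgue (\<lambda>x. indicator (box a b) x *\<^sub>R (indicator \<Omega> x *\<^sub>R w x))"
        by (rule integrable_mult_indicator[OF lebesgue_box])
      also have "(\<lambda>x. indicator (box a b) x *\<^sub>R (indicator \<Omega> x *\<^sub>R w x)) = h"
        using box_sub by (auto simp: fun_eq_iff h_def indicator_def)
      finally show ?thesis .
    qed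
    have set0: "(LINT x:box c d|lebesgue. h x) = 0" for c d
    proof -
      \<comment> \<open>An integral of \<open>h\<close> over any box is one of \<open>w\<close> over
        a box inside \<open>box a b\<close>; if that box is nonempty, its closure still lies in
        \<open>cbox a b\<close>.\<close>
      obtain c' d' where cd: "box a b \<inter> box c d = box c' d'" by (auto simp: box_Int_box)
      have "(LINT x:box c d|lebesgue. h x) = (\<integral>x. w x * indicator (box c' d') x \<partial>dx)"
        unfolding set_lebesgue_integral_def cd[symmetric]
        using box_sub
        by (subst integral_restrict_space, simp, intro Bochner_Integration.integral_cong refl)
           (auto simp: h_def indicator_def)
      also have "\<dots> = 0"
      proof (cases "box c' d' = {}")
        case False
        then have "cbox c' d' = closure (box c' d')" by simp
        also have "\<dots> \<subseteq> cbox a b"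
          using cd box_subset_cbox[of a b] by (intro closure_minimal) auto
        finally show ?thesis using box0 ab by blast
      qed simp
      finally show ?thesis .
    qed
    have "integral\<^sup>L lebesgue h = (LINT x:box a b|lebesgue. h x)"
      unfolding set_lebesgue_integral_def by (intro Bochner_Integration.integral_cong) (auto simp: h_def indicator_def)
    then have "AE x in lebesgue. h x = 0"
      using AE_eq_0_of_box_integrals_lebesgue[OF int_h] set0 by simp
    \<comment> \<open>The cut-off uses the open box, the cover uses closed ones; the faces in
      between are null.\<close>
    moreover have "AE x in lebesgue. x \<notin> cbox a b - box a b"
      using negligible_frontier_interval[of a b] by (intro AE_not_in) (simp add: negligible_iff_null_sets)
    ultimately show ?thesis by eventually_elim (auto simp: h_def)
  qed
  obtain \<D> where \<D>: "countable \<D>" "\<D> \<subseteq> Pow \<Omega>" "\<And>X. X \<in> \<D> \<Longrightarrow> \<exists>a b. X = cbox a b" "\<Union>\<D> = \<Omega>"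
    using open_countable_Union_open_cbox[OF open_domain] by metis
  have "AE x in lebesgue. \<forall>X\<in>\<D>. x \<in> X \<longrightarrow> w x = 0"
    unfolding AE_ball_countable[OF \<D>(1)]
  proof
    fix X assume X: "X \<in> \<D>"
    then obtain a b where "X = cbox a b" using \<D>(3) by blast
    then show "AE x in lebesgue. x \<in> X \<longrightarrow> w x = 0" using local[of a b] \<D>(2) X by auto
  qed
  then show ?thesis unfolding AE_dx by eventually_elim (use \<D>(4) in blast)
qed

end

section \<open>Weak derivatives\<close>

context bounded_domain
begin

lemma continuous_borel_measurable_dx:
  fixes f :: "real^'n \<Rightarrow> real"
  assumes "continuous_on UNIV f"
  shows "f \<in> borel_measurable dx"
proof -
  have "f \<in> borel_measurable borel" using assms by (rule borel_measurable_continuous_onI)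
  then have "f \<in> borel_measurable lebesgue" by (simp add: measurable_completion)
  then show ?thesis by (rule measurable_restrict_space1)
qed

lemma continuous_bounded_on_domain:
  fixes f :: "real^'n \<Rightarrow> real"
  assumes "continuous_on UNIV f"
  obtains K where "\<And>x. x \<in> \<Omega> \<Longrightarrow> \<bar>f x\<bar> \<le> K"
proof -
  have "compact (f ` closure \<Omega>)"
    using bounded_domain by (intro compact_continuous_image continuous_on_subset[OF assms]) auto
  then obtain K where "\<forall>y\<in>f ` closure \<Omega>. norm y \<le> K"
    using compact_imp_bounded bounded_iff by metis
  then have "\<bar>f x\<bar> \<le> K" if "x \<in> \<Omega>" for x
    using that closure_subset[of \<Omega>] by auto
  then show thesis by (rule that)
qed

lemma continuous_L2:
  assumes "continuous_on UNIV f"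
  shows "f \<in> L2 \<Omega>"
  using continuous_bounded_on_domain[OF assms] L2_bounded[OF continuous_borel_measurable_dx[OF assms]]
  by metis

lemma smooth_partial_deriv_continuous:
  assumes "\<And>k. Ck_on k UNIV f"
  shows "continuous_on UNIV (partial_deriv i f)"
  using assms[of 1] by (simp add: partial_deriv_def[abs_def])

lemma smooth_continuous: "(\<And>k. Ck_on k UNIV f) \<Longrightarrow> continuous_on UNIV f"
  using Ck_on.simps(1) by metis

lemma test_functionsD:
  assumes "\<phi> \<in> test_functions \<Omega>"
  shows "Ck_on k UNIV \<phi>" "\<phi> \<in> L2 \<Omega>" "partial_deriv i \<phi> \<in> L2 \<Omega>"
proof -
  show *: "Ck_on k UNIV \<phi>" for k using assms by (simp add: test_functions_def)
  show "\<phi> \<in> L2 \<Omega>" by (intro continuous_L2 smooth_continuous *)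
  show "partial_deriv i \<phi> \<in> L2 \<Omega>" by (intro continuous_L2 smooth_partial_deriv_continuous *)
qed

lemma smooth_mult_test_function:
  assumes "\<And>k. Ck_on k UNIV m" "\<phi> \<in> test_functions \<Omega>"
  shows "(\<lambda>x. m x * \<phi> x) \<in> test_functions \<Omega>"
  using assms by (force simp: test_functions_def intro: Ck_on_mult)

lemma partial_deriv_mult:
  assumes "\<And>k. Ck_on k UNIV f" "\<And>k. Ck_on k UNIV g"
  shows "partial_deriv i (\<lambda>x. f x * g x) x = f x * partial_deriv i g x + partial_deriv i f x * g x"
proof -
  have "f differentiable (at x)" "g differentiable (at x)"
    using assms(1)[of 1] assms(2)[of 1] by auto
  then have "((\<lambda>x. f x * g x) has_derivative
      (\<lambda>v. f x * frechet_derivative g (at x) v + frechet_derivative f (at x) v * g x)) (at x)"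
    by (intro has_derivative_mult) (auto simp: frechet_derivative_works[symmetric])
  then show ?thesis by (simp add: partial_deriv_def frechet_derivative_eqI)
qed

lemma is_weak_deriv_iff:
  "is_weak_deriv \<Omega> i f g \<longleftrightarrow> g \<in> L2 \<Omega> \<and>
     (\<forall>\<phi>\<in>test_functions \<Omega>. (\<integral>x. f x * partial_deriv i \<phi> x \<partial>dx) = - (\<integral>x. g x * \<phi> x \<partial>dx))"
  by (simp add: is_weak_deriv_def LINT_dx)

text \<open>This makes the choice in \<open>weak_deriv\<close> harmless: any weak derivative found
  by calculation agrees with it almost everywhere.\<close>

lemma is_weak_deriv_unique:
  assumes "is_weak_deriv \<Omega> i f g" "is_weak_deriv \<Omega> i f h"
  shows "AE x in dx. g x = h x"
proof -
  have L2: "g \<in> L2 \<Omega>" "h \<in> L2 \<Omega>" using assms by (auto simp: is_weak_deriv_iff)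
  have "AE x in dx. g x - h x = 0"
  proof (rule fundamental_lemma_of_variations)
    show "(\<lambda>x. g x - h x) \<in> L2 \<Omega>" using L2 by (rule L2_diff)
    fix \<phi> assume \<phi>: "\<phi> \<in> test_functions \<Omega>"
    have "(\<integral>x. g x * \<phi> x \<partial>dx) = (\<integral>x. h x * \<phi> x \<partial>dx)"
      using assms \<phi> by (simp add: is_weak_deriv_iff)
    then show "(\<integral>x. (g x - h x) * \<phi> x \<partial>dx) = 0"
      using L2_mult_integrable[OF L2(1) test_functionsD(2)[OF \<phi>]]
        L2_mult_integrable[OF L2(2) test_functionsD(2)[OF \<phi>]]
      by (simp add: left_diff_distrib)
  qed
  then show ?thesis by simp
qed

text \<open>Equality of the predicates, not mere equivalence almost everywhere of their witnesses:
  \<open>weak_deriv\<close> then picks literally the same representative for both functions.\<close>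

lemma is_weak_deriv_cong_AE:
  assumes "f \<in> borel_measurable dx" "f' \<in> borel_measurable dx" "AE x in dx. f x = f' x"
  shows "is_weak_deriv \<Omega> i f = is_weak_deriv \<Omega> i f'"
proof -
  have "(\<integral>x. f x * partial_deriv i \<phi> x \<partial>dx) = (\<integral>x. f' x * partial_deriv i \<phi> x \<partial>dx)"
    if "\<phi> \<in> test_functions \<Omega>" for \<phi>
    using assms test_functionsD(3)[OF that, of i]
    by (intro integral_cong_AE) (auto simp: mem_L2_iff)
  then show ?thesis by (auto simp: is_weak_deriv_iff fun_eq_iff)
qed

lemma is_weak_deriv_lincomb:
  assumes f: "f \<in> L2 \<Omega>" "f' \<in> L2 \<Omega>" and g: "is_weak_deriv \<Omega> i f g" "is_weak_deriv \<Omega> i f' g'"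
  shows "is_weak_deriv \<Omega> i (\<lambda>x. \<alpha> * f x + \<beta> * f' x) (\<lambda>x. \<alpha> * g x + \<beta> * g' x)"
  unfolding is_weak_deriv_iff
proof (intro conjI ballI)
  have L2: "g \<in> L2 \<Omega>" "g' \<in> L2 \<Omega>" using g by (auto simp: is_weak_deriv_iff)
  then show "(\<lambda>x. \<alpha> * g x + \<beta> * g' x) \<in> L2 \<Omega>" by (intro L2_add L2_cmult)
  fix \<phi> assume \<phi>: "\<phi> \<in> test_functions \<Omega>"
  note \<phi>' = test_functionsD[OF \<phi>]
  have eq: "(\<integral>x. (\<alpha> * u x + \<beta> * u' x) * \<psi> x \<partial>dx) = \<alpha> * (\<integral>x. u x * \<psi> x \<partial>dx) + \<beta> * (\<integral>x. u' x * \<psi> x \<partial>dx)"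
    if "u \<in> L2 \<Omega>" "u' \<in> L2 \<Omega>" "\<psi> \<in> L2 \<Omega>" for u u' \<psi>
    using L2_mult_integrable[OF that(1,3)] L2_mult_integrable[OF that(2,3)]
    by (simp add: distrib_right mult.assoc)
  show "(\<integral>x. (\<alpha> * f x + \<beta> * f' x) * partial_deriv i \<phi> x \<partial>dx) = - (\<integral>x. (\<alpha> * g x + \<beta> * g' x) * \<phi> x \<partial>dx)"
    using g \<phi> by (simp add: eq f L2 \<phi>' is_weak_deriv_iff)
qed

lemma weak_deriv_works: "is_weak_deriv \<Omega> i f g \<Longrightarrow> is_weak_deriv \<Omega> i f (weak_deriv \<Omega> i f)"
  unfolding weak_deriv_def by (rule someI[of "is_weak_deriv \<Omega> i f"])

lemma H1D:
  assumes "f \<in> H1 \<Omega>"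
  shows "f \<in> L2 \<Omega>" "is_weak_deriv \<Omega> i f (weak_deriv \<Omega> i f)" "weak_deriv \<Omega> i f \<in> L2 \<Omega>"
proof -
  show "f \<in> L2 \<Omega>" using assms by (simp add: H1_def)
  show *: "is_weak_deriv \<Omega> i f (weak_deriv \<Omega> i f)"
    using assms weak_deriv_works unfolding H1_def by blast
  then show "weak_deriv \<Omega> i f \<in> L2 \<Omega>" by (simp add: is_weak_deriv_iff)
qed

lemma H10_H1: "f \<in> H10 \<Omega> \<Longrightarrow> f \<in> H1 \<Omega>"
  by (simp add: H10_def)

lemma weak_deriv_eq_AE:
  assumes "is_weak_deriv \<Omega> i f g"
  shows "AE x in dx. weak_deriv \<Omega> i f x = g x"
  using assms weak_deriv_works is_weak_deriv_unique by blast

lemma H1_lincomb: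
  assumes "f \<in> H1 \<Omega>" "g \<in> H1 \<Omega>"
  shows "(\<lambda>x. \<alpha> * f x + \<beta> * g x) \<in> H1 \<Omega>"
    and "AE x in dx. weak_deriv \<Omega> i (\<lambda>x. \<alpha> * f x + \<beta> * g x) x
           = \<alpha> * weak_deriv \<Omega> i f x + \<beta> * weak_deriv \<Omega> i g x"
proof -
  have *: "is_weak_deriv \<Omega> i (\<lambda>x. \<alpha> * f x + \<beta> * g x)
      (\<lambda>x. \<alpha> * weak_deriv \<Omega> i f x + \<beta> * weak_deriv \<Omega> i g x)" for i
    using assms by (intro is_weak_deriv_lincomb H1D)
  show "(\<lambda>x. \<alpha> * f x + \<beta> * g x) \<in> H1 \<Omega>"
  proof -
    have "(\<lambda>x. \<alpha> * f x + \<beta> * g x) \<in> L2 \<Omega>" using assms by (intro L2_add L2_cmult H1D(1))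
    then show ?thesis using * unfolding H1_def by blast
  qed
  show "AE x in dx. weak_deriv \<Omega> i (\<lambda>x. \<alpha> * f x + \<beta> * g x) x
           = \<alpha> * weak_deriv \<Omega> i f x + \<beta> * weak_deriv \<Omega> i g x"
    by (rule weak_deriv_eq_AE[OF *])
qed

lemma smooth_mult_L2:
  assumes "continuous_on UNIV m" "f \<in> L2 \<Omega>"
  shows "(\<lambda>x. m x * f x) \<in> L2 \<Omega>"
  by (metis L2_mult_bounded assms continuous_bounded_on_domain continuous_borel_measurable_dx)

text \<open>\<open>m\<close> is moved onto the test function: \<open>m x * \<phi> x\<close> is again
  a test function, and the product rule splits its derivative.\<close>

lemma is_weak_deriv_smooth_mult:
  assumes m: "\<And>k. Ck_on k UNIV m" and f: "f \<in> L2 \<Omega>" and g: "is_weak_deriv \<Omega> i f g"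
  shows "is_weak_deriv \<Omega> i (\<lambda>x. m x * f x) (\<lambda>x. partial_deriv i m x * f x + m x * g x)"
  unfolding is_weak_deriv_iff
proof (intro conjI ballI)
  note cont = smooth_continuous[OF m] smooth_partial_deriv_continuous[OF m]
  have g2: "g \<in> L2 \<Omega>" using g by (simp add: is_weak_deriv_iff)
  show L2: "(\<lambda>x. partial_deriv i m x * f x + m x * g x) \<in> L2 \<Omega>"
    by (intro L2_add smooth_mult_L2 cont f g2)
  fix \<phi> assume \<phi>: "\<phi> \<in> test_functions \<Omega>"
  note \<phi>' = test_functionsD[OF \<phi>]
  have "(\<integral>x. f x * partial_deriv i (\<lambda>x. m x * \<phi> x) x \<partial>dx) = - (\<integral>x. g x * (m x * \<phi> x) \<partial>dx)"
    using g smooth_mult_test_function[OF m \<phi>] by (simp add: is_weak_deriv_iff)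
  moreover have "f x * partial_deriv i (\<lambda>x. m x * \<phi> x) x
      = m x * f x * partial_deriv i \<phi> x + partial_deriv i m x * f x * \<phi> x" for x
    using partial_deriv_mult[OF m \<phi>'(1), of i x] by (simp add: algebra_simps)
  moreover have "integrable dx (\<lambda>x. m x * f x * partial_deriv i \<phi> x)"
    "integrable dx (\<lambda>x. partial_deriv i m x * f x * \<phi> x)" "integrable dx (\<lambda>x. m x * g x * \<phi> x)"
    by (intro L2_mult_integrable smooth_mult_L2 cont f g2 \<phi>')+
  ultimately show "(\<integral>x. m x * f x * partial_deriv i \<phi> x \<partial>dx)
      = - (\<integral>x. (partial_deriv i m x * f x + m x * g x) * \<phi> x \<partial>dx)"
    by (simp add: algebra_simps)
qed

text \<open>For a test function \<open>v\<close> this is the definition of a weak derivative, and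
  both sides are continuous in \<open>v\<close> by Cauchy-Schwarz. No boundary term arises because
  \<open>H10\<close> is the closure of the test functions.\<close>

lemma H10_integration_by_parts:
  assumes f: "f \<in> L2 \<Omega>" and g: "is_weak_deriv \<Omega> i f g" and v: "v \<in> H10 \<Omega>"
  shows "(\<integral>x. f x * weak_deriv \<Omega> i v x \<partial>dx) = - (\<integral>x. g x * v x \<partial>dx)"
proof -
  let ?d = "weak_deriv \<Omega> i v"
  have g2: "g \<in> L2 \<Omega>" using g by (simp add: is_weak_deriv_iff)
  have v2: "v \<in> L2 \<Omega>" "?d \<in> L2 \<Omega>" using H1D[OF H10_H1[OF v]] by auto
  define I where "I = (\<integral>x. f x * ?d x \<partial>dx) + (\<integral>x. g x * v x \<partial>dx)"
  have est: "\<bar>I\<bar> \<le> (L2_norm \<Omega> f + L2_norm \<Omega> g) * \<epsilon>" if \<epsilon>: "\<epsilon> > 0" for \<epsilon>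
  proof -
    obtain \<phi> where \<phi>: "\<phi> \<in> test_functions \<Omega>" "L2_norm \<Omega> (\<lambda>x. v x - \<phi> x) < \<epsilon>"
      "L2_norm \<Omega> (\<lambda>x. ?d x - partial_deriv i \<phi> x) < \<epsilon>"
      using v \<epsilon> unfolding H10_def by blast
    note \<phi>' = test_functionsD(2,3)[OF \<phi>(1)]
    have "(\<integral>x. f x * (?d x - partial_deriv i \<phi> x) \<partial>dx) + (\<integral>x. g x * (v x - \<phi> x) \<partial>dx)
        = I - ((\<integral>x. f x * partial_deriv i \<phi> x \<partial>dx) + (\<integral>x. g x * \<phi> x \<partial>dx))"
      using L2_mult_integrable[OF f v2(2)] L2_mult_integrable[OF f \<phi>'(2)]
        L2_mult_integrable[OF g2 v2(1)] L2_mult_integrable[OF g2 \<phi>'(1)]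
      by (simp add: right_diff_distrib I_def)
    \<comment> \<open>The two integrals against the test function cancel, so only the approximation
      errors remain.\<close>
    then have "I = (\<integral>x. f x * (?d x - partial_deriv i \<phi> x) \<partial>dx) + (\<integral>x. g x * (v x - \<phi> x) \<partial>dx)"
      using g \<phi>(1) by (simp add: is_weak_deriv_iff)
    also have "\<bar>\<dots>\<bar> \<le> \<bar>\<integral>x. f x * (?d x - partial_deriv i \<phi> x) \<partial>dx\<bar> + \<bar>\<integral>x. g x * (v x - \<phi> x) \<partial>dx\<bar>"
      by (rule abs_triangle_ineq)
    also have "\<dots> \<le> L2_norm \<Omega> f * L2_norm \<Omega> (\<lambda>x. ?d x - partial_deriv i \<phi> x)
        + L2_norm \<Omega> g * L2_norm \<Omega> (\<lambda>x. v x - \<phi> x)"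
      by (intro add_mono L2_Cauchy_Schwarz f g2 L2_diff v2 \<phi>')
    also have "\<dots> \<le> L2_norm \<Omega> f * \<epsilon> + L2_norm \<Omega> g * \<epsilon>"
      using \<phi> by (intro add_mono mult_left_mono L2_norm_nonneg) auto
    finally show ?thesis by (simp add: distrib_right)
  qed
  have "\<bar>I\<bar> \<le> 0"
  proof (rule field_le_epsilon)
    fix \<epsilon> :: real assume "\<epsilon> > 0"
    define K where "K = L2_norm \<Omega> f + L2_norm \<Omega> g + 1"
    have K: "K > 0" using L2_norm_nonneg[of f] L2_norm_nonneg[of g] by (simp add: K_def)
    then have "\<bar>I\<bar> \<le> (L2_norm \<Omega> f + L2_norm \<Omega> g) * (\<epsilon> / K)" using est[of "\<epsilon> / K"] \<open>\<epsilon> > 0\<close> by simp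
    also have "\<dots> \<le> K * (\<epsilon> / K)" using K \<open>\<epsilon> > 0\<close> by (intro mult_right_mono) (auto simp: K_def)
    finally show "\<bar>I\<bar> \<le> 0 + \<epsilon>" using K by simp
  qed
  then show ?thesis by (simp add: I_def)
qed

end

section \<open>The energy form and Green's formula\<close>

locale elliptic_domain = bounded_domain \<Omega> for \<Omega> :: "(real^'n) set" +
  fixes M :: "real^'n \<Rightarrow> real^'n^'n"
  assumes smooth: "smooth_on_closure \<Omega> M"
    and symmetric: "\<And>x. x \<in> closure \<Omega> \<Longrightarrow> transpose (M x) = M x"
    and positive: "\<exists>\<mu>>0. \<forall>x\<in>closure \<Omega>. \<forall>\<xi>. \<mu> * (norm \<xi>)\<^sup>2 \<le> \<xi> \<bullet> (M x *v \<xi>)"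
begin

lemma M_nonneg: "x \<in> \<Omega> \<Longrightarrow> 0 \<le> \<xi> \<bullet> (M x *v \<xi>)"
  using positive closure_subset[of \<Omega>]
  by (meson less_imp_le mult_nonneg_nonneg order_trans subsetD zero_le_power2)

lemma M_sym: "x \<in> \<Omega> \<Longrightarrow> \<xi> \<bullet> (M x *v \<eta>) = \<eta> \<bullet> (M x *v \<xi>)"
  by (metis closure_subset dot_lmul_matrix inner_commute subsetD symmetric transpose_matrix_vector)

text \<open>By symmetry of the root one factor moves across the inner product. From here on the
  gradient norm is a polynomial in the entries of \<open>M\<close>.\<close>

lemma norm_matrix_sqrt_mult:
  assumes x: "x \<in> \<Omega>"
  shows "(norm (matrix_sqrt (M x) *v \<xi>))\<^sup>2 = \<xi> \<bullet> (M x *v \<xi>)"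
proof -
  define B where "B = matrix_sqrt (M x)"
  have "transpose (M x) = M x" using x closure_subset symmetric by blast
  then have "\<exists>B. transpose B = B \<and> (\<forall>\<xi>. 0 \<le> \<xi> \<bullet> (B *v \<xi>)) \<and> B ** B = M x"
    using M_nonneg[OF x] by (rule matrix_square_root_exists)
  then have "transpose B = B \<and> (\<forall>\<xi>. 0 \<le> \<xi> \<bullet> (B *v \<xi>)) \<and> B ** B = M x"
    unfolding B_def matrix_sqrt_def by (rule someI_ex)
  then have B: "transpose B = B" "B ** B = M x" by auto
  have "(norm (B *v \<xi>))\<^sup>2 = (B *v \<xi>) \<bullet> (B *v \<xi>)" by (rule power2_norm_eq_inner)
  also have "\<dots> = \<xi> \<bullet> (B *v (B *v \<xi>))"
    using B(1) by (metis dot_lmul_matrix transpose_matrix_vector)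
  also have "\<dots> = \<xi> \<bullet> (M x *v \<xi>)" using B(2) by (simp add: matrix_vector_mul_assoc)
  finally show ?thesis by (simp add: B_def)
qed

text \<open>The pairs below are (velocity, gradient).\<close>

definition energy_density :: "real^'n \<Rightarrow> real \<times> (real^'n) \<Rightarrow> real \<times> (real^'n) \<Rightarrow> real" where
  "energy_density x z y = fst z * fst y + snd z \<bullet> (M x *v snd y)"

text \<open>The polarisation of twice the energy, a positive semidefinite symmetric bilinear form on
  \<open>fields\<close>.\<close>

definition form :: "(real^'n \<Rightarrow> real \<times> (real^'n)) \<Rightarrow> (real^'n \<Rightarrow> real \<times> (real^'n)) \<Rightarrow> real" where
  "form z y = (\<integral>x. energy_density x (z x) (y x) \<partial>dx)"

text \<open>The second component may be any vector field, not just a gradient: pointwise sums and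
  multiples then stay inside, whereas \<open>state\<close> is linear only almost everywhere.\<close>

definition fields :: "(real^'n \<Rightarrow> real \<times> (real^'n)) set" where
  "fields = {z. (\<lambda>x. fst (z x)) \<in> L2 \<Omega> \<and> (\<forall>i. (\<lambda>x. snd (z x) $ i) \<in> L2 \<Omega>)}"

definition state :: "(real^'n \<Rightarrow> real) \<Rightarrow> (real^'n \<Rightarrow> real) \<Rightarrow> real^'n \<Rightarrow> real \<times> (real^'n)" where
  "state v w x = (w x, \<chi> j. weak_deriv \<Omega> j v x)"

text \<open>The product rule for weak derivatives asks for multipliers smooth on the whole space,
  which the extension in \<open>smooth_on_closure\<close> provides.\<close>

lemma smooth_entries:
  obtains m where "\<And>i j k. Ck_on k UNIV (m i j)" "\<And>i j x. x \<in> \<Omega> \<Longrightarrow> M x $ i $ j = m i j x"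
proof -
  obtain F where F: "\<And>k. Ck_on k UNIV F" "\<And>x. x \<in> closure \<Omega> \<Longrightarrow> F x = M x"
    using smooth unfolding smooth_on_closure_def by blast
  have "bounded_linear (\<lambda>A :: real^'n^'n. A $ i $ j)" for i j
    using bounded_linear_compose[OF bounded_linear_vec_nth bounded_linear_vec_nth] .
  then have "Ck_on k UNIV (\<lambda>x. F x $ i $ j)" for i j k
    by (rule Ck_on_bounded_linear[OF _ F(1)])
  moreover have "M x $ i $ j = F x $ i $ j" if "x \<in> \<Omega>" for x i j
    using F(2)[of x] that closure_subset[of \<Omega>] by (simp add: subset_iff)
  ultimately show thesis using that[of "\<lambda>i j x. F x $ i $ j"] by blast
qed

lemma inner_matrix_sum: "\<xi> \<bullet> (A *v \<eta>) = (\<Sum>i\<in>UNIV. \<Sum>j\<in>UNIV. A $ i $ j * \<xi> $ i * \<eta> $ j)"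
  for \<xi> \<eta> :: "real^'n"
  by (simp add: inner_vec_def matrix_vector_mult_def sum_distrib_left ac_simps)

lemma L2_cong:
  assumes "\<And>x. x \<in> \<Omega> \<Longrightarrow> f x = f' x"
  shows "f \<in> L2 \<Omega> \<longleftrightarrow> f' \<in> L2 \<Omega>"
proof -
  have "f \<in> borel_measurable dx \<longleftrightarrow> f' \<in> borel_measurable dx"
    by (rule measurable_cong) (simp add: assms)
  moreover have "integrable dx (\<lambda>x. (f x)\<^sup>2) \<longleftrightarrow> integrable dx (\<lambda>x. (f' x)\<^sup>2)"
    by (rule Bochner_Integration.integrable_cong) (simp_all add: assms)
  ultimately show ?thesis by (simp add: mem_L2_iff)
qed

lemma entry_mult_L2:
  assumes "f \<in> L2 \<Omega>"
  shows "(\<lambda>x. M x $ i $ j * f x) \<in> L2 \<Omega>"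
proof -
  obtain m where m: "\<And>i j k. Ck_on k UNIV (m i j)" "\<And>i j x. x \<in> \<Omega> \<Longrightarrow> M x $ i $ j = m i j x"
    by (rule smooth_entries) blast
  have "(\<lambda>x. m i j x * f x) \<in> L2 \<Omega>" by (intro smooth_mult_L2 smooth_continuous m assms)
  then show ?thesis using L2_cong[of "\<lambda>x. M x $ i $ j * f x"] m(2) by simp
qed

lemma energy_density_integrable:
  assumes "z \<in> fields" "y \<in> fields"
  shows "integrable dx (\<lambda>x. energy_density x (z x) (y x))"
proof -
  have "integrable dx (\<lambda>x. M x $ i $ j * snd (z x) $ i * snd (y x) $ j)" for i j
    using assms unfolding fields_def by (intro L2_mult_integrable entry_mult_L2) auto
  moreover have "integrable dx (\<lambda>x. fst (z x) * fst (y x))"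
    using assms unfolding fields_def by (intro L2_mult_integrable) auto
  ultimately show ?thesis
    unfolding energy_density_def inner_matrix_sum by simp
qed

lemma density_add_left: "energy_density x (a + b) c = energy_density x a c + energy_density x b c"
  by (simp add: energy_density_def distrib_right inner_add_left)

lemma density_diff_left: "energy_density x (a - b) c = energy_density x a c - energy_density x b c"
  by (simp add: energy_density_def left_diff_distrib inner_diff_left)

lemma density_scale_left: "energy_density x (t *\<^sub>R a) c = t * energy_density x a c"
  by (simp add: energy_density_def distrib_left mult.assoc)

lemma energy_density_commute: "x \<in> \<Omega> \<Longrightarrow> energy_density x a b = energy_density x b a"
  using M_sym by (simp add: energy_density_def mult.commute)

lemma energy_density_nonneg: "x \<in> \<Omega> \<Longrightarrow> 0 \<le> energy_density x a a"
  using M_nonneg by (simp add: energy_density_def)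

lemma fields_diff: "z \<in> fields \<Longrightarrow> y \<in> fields \<Longrightarrow> (\<lambda>x. z x - y x) \<in> fields"
  by (auto simp: fields_def intro: L2_diff)

lemma fields_add: "z \<in> fields \<Longrightarrow> y \<in> fields \<Longrightarrow> (\<lambda>x. z x + y x) \<in> fields"
  by (auto simp: fields_def intro: L2_add)

lemma fields_scale: "z \<in> fields \<Longrightarrow> (\<lambda>x. t *\<^sub>R z x) \<in> fields"
  by (auto simp: fields_def intro: L2_cmult)

lemma form_add_left:
  "z \<in> fields \<Longrightarrow> z' \<in> fields \<Longrightarrow> y \<in> fields \<Longrightarrow> form (\<lambda>x. z x + z' x) y = form z y + form z' y"
  by (simp add: form_def density_add_left energy_density_integrable)

lemma form_diff_left:
  "z \<in> fields \<Longrightarrow> z' \<in> fields \<Longrightarrow> y \<in> fields \<Longrightarrow> form (\<lambda>x. z x - z' x) y = form z y - form z' y"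
  by (simp add: form_def density_diff_left energy_density_integrable)

lemma form_scale_left: "form (\<lambda>x. t *\<^sub>R z x) y = t * form z y"
  by (simp add: form_def density_scale_left)

lemma form_commute: "form z y = form y z"
  unfolding form_def by (intro Bochner_Integration.integral_cong) (auto simp: energy_density_commute)

lemma form_nonneg: "0 \<le> form z z"
  unfolding form_def by (intro integral_nonneg_AE AE_I2) (simp add: energy_density_nonneg)

lemma form_Cauchy_Schwarz:
  assumes "z \<in> fields" "y \<in> fields"
  shows "\<bar>form z y\<bar> \<le> sqrt (form z z) * sqrt (form y y)"
proof -
  have "(form z y)\<^sup>2 \<le> form z z * form y y"
  proof (rule quadratic_nonneg_imp_square_le)
    fix t
    let ?y = "\<lambda>x. t *\<^sub>R y x"
    have y: "?y \<in> fields" by (intro fields_scale assms)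
    have "0 \<le> form (\<lambda>x. z x + ?y x) (\<lambda>x. z x + ?y x)" by (rule form_nonneg)
    also have "\<dots> = form z (\<lambda>x. z x + ?y x) + form ?y (\<lambda>x. z x + ?y x)"
      using assms y by (intro form_add_left fields_add)
    also have "\<dots> = (form z z + form ?y z) + (form z ?y + form ?y ?y)"
      using assms y by (simp add: form_commute[of _ "\<lambda>x. z x + ?y x"] form_add_left)
    also have "\<dots> = form z z + 2 * t * form z y + t\<^sup>2 * form y y"
      by (simp add: form_scale_left form_commute[of _ ?y] form_commute[of y z] power2_eq_square)
    finally show "0 \<le> form z z + 2 * t * form z y + t\<^sup>2 * form y y" .
  qed (rule form_nonneg)
  then show ?thesis
    by (metis real_sqrt_abs real_sqrt_le_mono real_sqrt_mult)
qed

lemma form_cong_AE: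
  assumes "z \<in> fields" "z' \<in> fields" "AE x in dx. z x = z' x"
  shows "form z z = form z' z'"
  unfolding form_def
proof (rule integral_cong_AE)
  show "AE x in dx. energy_density x (z x) (z x) = energy_density x (z' x) (z' x)"
    using assms(3) by eventually_elim simp
qed (use assms(1,2) energy_density_integrable in auto)

lemma state_fields: "v \<in> H1 \<Omega> \<Longrightarrow> w \<in> L2 \<Omega> \<Longrightarrow> state v w \<in> fields"
  by (simp add: fields_def state_def H1D)

lemma norm_nabla_square:
  "x \<in> \<Omega> \<Longrightarrow> (norm (nabla M \<Omega> v x))\<^sup>2 = snd (state v w x) \<bullet> (M x *v snd (state v w x))"
  by (simp add: nabla_def norm_matrix_sqrt_mult state_def)

text \<open>The integrands agree at every point of the domain, so the identity holds even for a
  non-integrable density, where both integrals are 0 by convention.\<close>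

lemma energy_eq_form: "energy M \<Omega> v w = form (state v w) (state v w) / 2"
proof -
  have "(\<integral>x. \<bar>w x\<bar>\<^sup>2 + (norm (nabla M \<Omega> v x))\<^sup>2 \<partial>dx) = form (state v w) (state v w)"
    unfolding form_def
    by (intro Bochner_Integration.integral_cong refl)
       (simp add: energy_density_def norm_nabla_square[of _ v w], simp add: state_def power2_eq_square)
  then show ?thesis by (simp add: energy_def LINT_dx)
qed

lemma H10_norm_nonneg: "H10_norm M \<Omega> v \<ge> 0"
  by (simp add: H10_norm_def LINT_dx)

lemma form_state:
  assumes "v \<in> H1 \<Omega>" "w \<in> L2 \<Omega>"
  shows "form (state v w) (state v w) = (L2_norm \<Omega> w)\<^sup>2 + (H10_norm M \<Omega> v)\<^sup>2"
proof -
  \<comment> \<open>Zero velocity isolates the gradient part, whose integrability allows splitting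
    the integral.\<close>
  have "(\<lambda>x. 0) \<in> L2 \<Omega>" by (intro L2_bounded[of _ 0]) auto
  then have "integrable dx (\<lambda>x. energy_density x (state v (\<lambda>x. 0) x) (state v (\<lambda>x. 0) x))"
    using assms by (intro energy_density_integrable state_fields)
  then have 1: "integrable dx (\<lambda>x. snd (state v w x) \<bullet> (M x *v snd (state v w x)))"
    by (simp add: energy_density_def state_def)
  have 2: "integrable dx (\<lambda>x. (w x)\<^sup>2)" using assms by (simp add: mem_L2_iff)
  have "form (state v w) (state v w)
      = (\<integral>x. (w x)\<^sup>2 + snd (state v w x) \<bullet> (M x *v snd (state v w x)) \<partial>dx)"
    by (simp add: form_def energy_density_def state_def power2_eq_square)
  also have "\<dots> = (\<integral>x. (w x)\<^sup>2 \<partial>dx) + (\<integral>x. snd (state v w x) \<bullet> (M x *v snd (state v w x)) \<partial>dx)"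
    using 1 2 by simp
  also have "(\<integral>x. snd (state v w x) \<bullet> (M x *v snd (state v w x)) \<partial>dx)
      = (\<integral>x. (norm (nabla M \<Omega> v x))\<^sup>2 \<partial>dx)"
    by (intro Bochner_Integration.integral_cong) (auto simp: norm_nabla_square[of _ v w])
  also have "\<dots> = (H10_norm M \<Omega> v)\<^sup>2"
    by (simp add: H10_norm_def LINT_dx)
  finally show ?thesis by (simp add: L2_norm_square)
qed

lemma state_lincomb_AE:
  assumes "v \<in> H1 \<Omega>" "v' \<in> H1 \<Omega>"
  shows "AE x in dx. state (\<lambda>x. \<alpha> * v x + \<beta> * v' x) (\<lambda>x. \<alpha> * w x + \<beta> * w' x) x
    = \<alpha> *\<^sub>R state v w x + \<beta> *\<^sub>R state v' w' x"
proof -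
  have "AE x in dx. \<forall>j\<in>UNIV. weak_deriv \<Omega> j (\<lambda>x. \<alpha> * v x + \<beta> * v' x) x
      = \<alpha> * weak_deriv \<Omega> j v x + \<beta> * weak_deriv \<Omega> j v' x"
    using assms by (intro AE_finite_allI H1_lincomb) auto
  then show ?thesis by eventually_elim (simp add: state_def vec_eq_iff)
qed

text \<open>The flux components \<open>F i j\<close> are weakly differentiable, being smooth
  multiples of H1 functions, and each is integrated by parts against \<open>w\<close>. The
  velocities \<open>h\<close> and \<open>k\<close> are placeholders that \<open>snd\<close>
  discards.\<close>

lemma Green_formula:
  assumes v: "v \<in> H2 \<Omega>" and w: "w \<in> H10 \<Omega>"
  shows "laplace M \<Omega> v \<in> L2 \<Omega>"
    and "(\<integral>x. snd (state w h x) \<bullet> (M x *v snd (state v k x)) \<partial>dx) = - (\<integral>x. laplace M \<Omega> v x * w x \<partial>dx)"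
proof -
  obtain m where m: "\<And>i j k. Ck_on k UNIV (m i j)" "\<And>i j x. x \<in> \<Omega> \<Longrightarrow> M x $ i $ j = m i j x"
    by (rule smooth_entries) blast
  define F where "F i j y = M y $ i $ j * weak_deriv \<Omega> j v y" for i j y
  have v1: "v \<in> H1 \<Omega>" "weak_deriv \<Omega> j v \<in> H1 \<Omega>" for j using v by (auto simp: H2_def)
  have w1: "w \<in> L2 \<Omega>" "weak_deriv \<Omega> i w \<in> L2 \<Omega>" for i using H1D[OF H10_H1[OF w]] by auto
  have F: "F i j \<in> L2 \<Omega>" for i j
    unfolding F_def by (intro entry_mult_L2 H1D v1)
  \<comment> \<open>The flux is exchanged for the one with extended coefficients, which coincides
    with it on the domain.\<close>
  have "is_weak_deriv \<Omega> i (F i j) = is_weak_deriv \<Omega> i (\<lambda>x. m i j x * weak_deriv \<Omega> j v x)" for i j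
  proof (rule is_weak_deriv_cong_AE)
    show "(\<lambda>x. m i j x * weak_deriv \<Omega> j v x) \<in> borel_measurable dx"
      by (intro L2_borel_measurable smooth_mult_L2 smooth_continuous m H1D v1)
    show "AE x in dx. F i j x = m i j x * weak_deriv \<Omega> j v x"
      by (rule AE_I2) (simp add: F_def m)
  qed (rule L2_borel_measurable[OF F])
  then have dF: "is_weak_deriv \<Omega> i (F i j) (weak_deriv \<Omega> i (F i j))" for i j
    using is_weak_deriv_smooth_mult[OF m(1) H1D(1)[OF v1(2)] H1D(2)[OF v1(2)]] weak_deriv_works by metis
  then have dF2: "weak_deriv \<Omega> i (F i j) \<in> L2 \<Omega>" for i j by (simp add: is_weak_deriv_iff)
  have lap: "laplace M \<Omega> v = (\<lambda>x. \<Sum>i\<in>UNIV. \<Sum>j\<in>UNIV. weak_deriv \<Omega> i (F i j) x)"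
    by (simp add: laplace_def F_def[abs_def] fun_eq_iff)
  show "laplace M \<Omega> v \<in> L2 \<Omega>" unfolding lap by (intro L2_sum dF2)
  have "(\<integral>x. snd (state w h x) \<bullet> (M x *v snd (state v k x)) \<partial>dx)
      = (\<integral>x. (\<Sum>i\<in>UNIV. \<Sum>j\<in>UNIV. F i j x * weak_deriv \<Omega> i w x) \<partial>dx)"
    by (simp add: inner_matrix_sum state_def F_def ac_simps)
  also have "\<dots> = (\<Sum>i\<in>UNIV. \<Sum>j\<in>UNIV. \<integral>x. F i j x * weak_deriv \<Omega> i w x \<partial>dx)"
    using F w1 by (simp add: Bochner_Integration.integral_sum L2_mult_integrable)
  also have "\<dots> = (\<Sum>i\<in>UNIV. \<Sum>j\<in>UNIV. - (\<integral>x. weak_deriv \<Omega> i (F i j) x * w x \<partial>dx))"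
    by (simp only: H10_integration_by_parts[OF F dF w])
  also have "\<dots> = - (\<integral>x. (\<Sum>i\<in>UNIV. \<Sum>j\<in>UNIV. weak_deriv \<Omega> i (F i j) x * w x) \<partial>dx)"
    using dF2 w1 by (simp add: Bochner_Integration.integral_sum L2_mult_integrable sum_negf)
  finally show "(\<integral>x. snd (state w h x) \<bullet> (M x *v snd (state v k x)) \<partial>dx) = - (\<integral>x. laplace M \<Omega> v x * w x \<partial>dx)"
    by (simp add: lap sum_distrib_right)
qed

end

section \<open>The energy identity\<close>

context elliptic_domain
begin

text \<open>The times approach \<open>t\<close> from the right, hence stay in [0,\<infinity>) even
  when \<open>t = 0\<close>.\<close>

lemma has_time_deriv_sequence:
  assumes "has_time_deriv S N u w t" "t \<ge> 0"
  shows "(\<lambda>n. N (\<lambda>x. (u (t + 1 / Suc n) x - u t x) * real (Suc n) - w x)) \<longlonglongrightarrow> 0"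
proof -
  have "filterlim (\<lambda>n. t + 1 / Suc n) (at t within {0..}) sequentially"
    unfolding filterlim_at
  proof
    show "(\<lambda>n. t + 1 / Suc n) \<longlonglongrightarrow> t"
      using tendsto_add[OF tendsto_const[of t] LIMSEQ_Suc[OF lim_1_over_n]] by simp
    show "\<forall>\<^sub>F n in sequentially. t + 1 / Suc n \<in> {0..} \<and> t + 1 / Suc n \<noteq> t"
      using assms(2) by (intro always_eventually allI) (auto intro!: add_nonneg_nonneg simp del: of_nat_Suc)
  qed
  from filterlim_compose[OF conjunct2[OF assms(1)[unfolded has_time_deriv_def]] this]
  show ?thesis by simp
qed

text \<open>With increment \<open>d n\<close> and error \<open>q n = d n / \<delta> n - w\<close>,
  expanding the square gives the quotient exactly as \<open>form w z0 + form (q n) z0 + form (d n)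
  (d n) / (2 * \<delta> n)\<close>. Cauchy-Schwarz removes the second term, the Lipschitz bound the
  third.\<close>

lemma form_difference_quotient_limit:
  fixes \<delta> :: "nat \<Rightarrow> real"
  assumes fields: "\<And>n. z n \<in> fields" "z0 \<in> fields" "w \<in> fields"
    and \<delta>: "\<delta> \<longlonglongrightarrow> 0" "\<And>n. \<delta> n > 0"
    and lip: "\<And>n. form (\<lambda>x. z n x - z0 x) (\<lambda>x. z n x - z0 x) \<le> L * (\<delta> n)\<^sup>2"
    and lim: "(\<lambda>n. form (\<lambda>x. (1 / \<delta> n) *\<^sub>R (z n x - z0 x) - w x) (\<lambda>x. (1 / \<delta> n) *\<^sub>R (z n x - z0 x) - w x))
        \<longlonglongrightarrow> 0"
  shows "(\<lambda>n. (form (z n) (z n) / 2 - form z0 z0 / 2) / \<delta> n) \<longlonglongrightarrow> form w z0"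
proof -
  define d where "d n x = z n x - z0 x" for n x
  define q where "q n x = (1 / \<delta> n) *\<^sub>R d n x - w x" for n x
  have d: "d n \<in> fields" for n unfolding d_def by (intro fields_diff fields)
  have q: "q n \<in> fields" for n unfolding q_def by (intro fields_diff fields_scale d fields)
  have quot: "(form (z n) (z n) / 2 - form z0 z0 / 2) / \<delta> n
      = form w z0 + form (q n) z0 + form (d n) (d n) / \<delta> n / 2" for n
  proof -
    have "form (z n) (z n) = form (\<lambda>x. d n x + z0 x) (\<lambda>x. d n x + z0 x)" by (simp add: d_def)
    also have "\<dots> = form (d n) (\<lambda>x. d n x + z0 x) + form z0 (\<lambda>x. d n x + z0 x)"
      by (intro form_add_left fields_add d fields)
    also have "\<dots> = form (d n) (d n) + 2 * form (d n) z0 + form z0 z0"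
      using d fields
      by (simp add: form_commute[of _ "\<lambda>x. d n x + z0 x"] form_add_left form_commute[of z0 "d n"])
    finally have "(form (z n) (z n) / 2 - form z0 z0 / 2) / \<delta> n
        = form (d n) z0 / \<delta> n + form (d n) (d n) / \<delta> n / 2"
      using \<delta>(2)[of n] by (simp add: field_simps)
    moreover have "form (q n) z0 = form (d n) z0 / \<delta> n - form w z0"
      unfolding q_def using d fields by (simp add: form_diff_left fields_scale form_scale_left)
    ultimately show ?thesis by simp
  qed
  have "(\<lambda>n. form (q n) z0) \<longlonglongrightarrow> 0"
  proof (rule Lim_null_comparison)
    show "\<forall>\<^sub>F n in sequentially. norm (form (q n) z0) \<le> sqrt (form (q n) (q n)) * sqrt (form z0 z0)"
      using form_Cauchy_Schwarz[OF q fields(2)] by simp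
    have "(\<lambda>n. form (q n) (q n)) \<longlonglongrightarrow> 0" using lim by (simp add: q_def[abs_def] d_def[abs_def])
    from tendsto_mult_left_zero[OF tendsto_real_sqrt[OF this, simplified]]
    show "(\<lambda>n. sqrt (form (q n) (q n)) * sqrt (form z0 z0)) \<longlonglongrightarrow> 0" .
  qed
  moreover have "(\<lambda>n. form (d n) (d n) / \<delta> n / 2) \<longlonglongrightarrow> 0"
  proof (rule Lim_null_comparison)
    show "\<forall>\<^sub>F n in sequentially. norm (form (d n) (d n) / \<delta> n / 2) \<le> \<bar>L\<bar> * \<delta> n"
    proof (intro always_eventually allI)
      fix n
      have "form (d n) (d n) \<le> \<bar>L\<bar> * (\<delta> n)\<^sup>2"
        using lip[of n] mult_right_mono[OF abs_ge_self[of L], of "(\<delta> n)\<^sup>2"] by (simp add: d_def[abs_def])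
      then have "form (d n) (d n) / \<delta> n \<le> \<bar>L\<bar> * \<delta> n"
        using \<delta>(2)[of n] by (simp add: divide_le_eq power2_eq_square mult.assoc)
      moreover have "0 \<le> form (d n) (d n) / \<delta> n" using \<delta>(2)[of n] form_nonneg by simp
      ultimately show "norm (form (d n) (d n) / \<delta> n / 2) \<le> \<bar>L\<bar> * \<delta> n" by simp
    qed
    show "(\<lambda>n. \<bar>L\<bar> * \<delta> n) \<longlonglongrightarrow> 0" using tendsto_mult_right_zero[OF \<delta>(1)] .
  qed
  ultimately have "(\<lambda>n. form w z0 + form (q n) z0 + form (d n) (d n) / \<delta> n / 2)
      \<longlonglongrightarrow> form w z0 + 0 + 0"
    by (intro tendsto_add tendsto_const)
  then show ?thesis unfolding quot by simp
qed

end

section \<open>The energy along a solution\<close>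

locale damped_wave = elliptic_domain \<Omega> M for \<Omega> :: "(real^'n) set" and M +
  fixes a :: "real^'n \<Rightarrow> real" and g :: "real \<Rightarrow> real"
    and u0 u1 :: "real^'n \<Rightarrow> real" and u :: "real \<Rightarrow> real^'n \<Rightarrow> real"
  assumes a: "a \<in> Linf_space \<Omega>" and g: "continuous_on UNIV g"
    and a_nonneg: "\<And>x. x \<in> \<Omega> \<Longrightarrow> a x \<ge> 0" and g_sign: "\<And>s. s * g s \<ge> 0"
    and u0: "u0 \<in> H2 \<Omega> \<inter> H10 \<Omega>" and u1: "u1 \<in> H10 \<Omega>"
    and solution: "damped_wave_solution M \<Omega> a g u0 u1 u"
begin

definition Z :: "real \<Rightarrow> real^'n \<Rightarrow> real \<times> (real^'n)" where
  "Z t = state (u t) (ddt \<Omega> u t)"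

definition energy_at :: "real \<Rightarrow> real" where
  "energy_at t = energy M \<Omega> (u t) (ddt \<Omega> u t)"

definition dissipation :: "real \<Rightarrow> real" where
  "dissipation t = (LINT x:\<Omega>|lebesgue. a x * g (ddt \<Omega> u t x) * ddt \<Omega> u t x)"

lemma u_H10: "t \<ge> 0 \<Longrightarrow> u t \<in> H10 \<Omega>"
  using solution by (simp add: damped_wave_solution_def continuous_in_def)

lemma u_H1: "t \<ge> 0 \<Longrightarrow> u t \<in> H1 \<Omega>"
  using u_H10 H10_H1 by blast

lemma ut_L2: "t \<ge> 0 \<Longrightarrow> ddt \<Omega> u t \<in> L2 \<Omega>"
  using solution by (simp add: damped_wave_solution_def continuous_in_def)

lemma Z_fields: "t \<ge> 0 \<Longrightarrow> Z t \<in> fields"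
  unfolding Z_def by (intro state_fields u_H1 ut_L2)

lemma energy_at_eq: "energy_at t = form (Z t) (Z t) / 2"
  by (simp add: energy_at_def Z_def energy_eq_form)

text \<open>The regularity of \<open>u\<close> is stated through norms of combinations such as
  \<open>u s - u t\<close>, whose \<open>weak_deriv\<close> is a separate choice. The identity
  transfers these norms to pointwise combinations of \<open>Z\<close>.\<close>

lemma form_Z_lincomb:
  assumes "s \<ge> 0" "t \<ge> 0"
  shows "form (\<lambda>x. \<alpha> *\<^sub>R Z s x + \<beta> *\<^sub>R Z t x) (\<lambda>x. \<alpha> *\<^sub>R Z s x + \<beta> *\<^sub>R Z t x)
    = (L2_norm \<Omega> (\<lambda>x. \<alpha> * ddt \<Omega> u s x + \<beta> * ddt \<Omega> u t x))\<^sup>2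
      + (H10_norm M \<Omega> (\<lambda>x. \<alpha> * u s x + \<beta> * u t x))\<^sup>2"
proof -
  have *: "(\<lambda>x. \<alpha> * u s x + \<beta> * u t x) \<in> H1 \<Omega>"
    "(\<lambda>x. \<alpha> * ddt \<Omega> u s x + \<beta> * ddt \<Omega> u t x) \<in> L2 \<Omega>"
    using assms by (intro H1_lincomb u_H1 L2_add L2_cmult ut_L2; simp)+
  show ?thesis
    unfolding form_state[OF *, symmetric]
  proof (rule form_cong_AE)
    show "AE x in dx. \<alpha> *\<^sub>R Z s x + \<beta> *\<^sub>R Z t x
        = state (\<lambda>x. \<alpha> * u s x + \<beta> * u t x) (\<lambda>x. \<alpha> * ddt \<Omega> u s x + \<beta> * ddt \<Omega> u t x) x"
      using state_lincomb_AE[OF u_H1[OF assms(1)] u_H1[OF assms(2)],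
          of \<alpha> \<beta> "ddt \<Omega> u s" "ddt \<Omega> u t"]
      by eventually_elim (simp add: Z_def)
  qed (use assms * in \<open>auto intro!: fields_add fields_scale Z_fields state_fields\<close>)
qed

lemma Z_lipschitz:
  obtains L where "\<And>s t. 0 \<le> s \<Longrightarrow> 0 \<le> t \<Longrightarrow>
    form (\<lambda>x. Z s x - Z t x) (\<lambda>x. Z s x - Z t x) \<le> L * (s - t)\<^sup>2"
proof -
  have "W1inf_in \<Omega> (H10 \<Omega>) (H10_norm M \<Omega>) u" "W1inf_in \<Omega> (L2 \<Omega>) (L2_norm \<Omega>) (ddt \<Omega> u)"
    using solution by (auto simp: damped_wave_solution_def)
  then obtain L L' where
    "\<forall>s\<ge>0. \<forall>t\<ge>0. H10_norm M \<Omega> (\<lambda>x. u s x - u t x) \<le> L * \<bar>s - t\<bar>"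
    "\<forall>s\<ge>0. \<forall>t\<ge>0. L2_norm \<Omega> (\<lambda>x. ddt \<Omega> u s x - ddt \<Omega> u t x) \<le> L' * \<bar>s - t\<bar>"
    unfolding W1inf_in_def by (elim conjE exE) rule
  then have L: "H10_norm M \<Omega> (\<lambda>x. u s x - u t x) \<le> L * \<bar>s - t\<bar>"
    and L': "L2_norm \<Omega> (\<lambda>x. ddt \<Omega> u s x - ddt \<Omega> u t x) \<le> L' * \<bar>s - t\<bar>"
    if "0 \<le> s" "0 \<le> t" for s t
    using that by auto
  show thesis
  proof
    fix s t :: real assume st: "0 \<le> s" "0 \<le> t"
    have "form (\<lambda>x. Z s x - Z t x) (\<lambda>x. Z s x - Z t x)
        = (L2_norm \<Omega> (\<lambda>x. ddt \<Omega> u s x - ddt \<Omega> u t x))\<^sup>2 + (H10_norm M \<Omega> (\<lambda>x. u s x - u t x))\<^sup>2"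
      using form_Z_lincomb[OF st, of 1 "-1"] by simp
    also have "\<dots> \<le> (L' * \<bar>s - t\<bar>)\<^sup>2 + (L * \<bar>s - t\<bar>)\<^sup>2"
      using st by (intro add_mono power_mono L L' L2_norm_nonneg H10_norm_nonneg)
    also have "\<dots> = (L'\<^sup>2 + L\<^sup>2) * (s - t)\<^sup>2" by (simp add: power_mult_distrib distrib_right)
    finally show "form (\<lambda>x. Z s x - Z t x) (\<lambda>x. Z s x - Z t x) \<le> (L'\<^sup>2 + L\<^sup>2) * (s - t)\<^sup>2" .
  qed
qed

lemma Z_bounded:
  obtains K where "\<And>t. 0 \<le> t \<Longrightarrow> form (Z t) (Z t) \<le> K"
proof -
  obtain K K' where K: "\<And>t. 0 \<le> t \<Longrightarrow> H10_norm M \<Omega> (u t) \<le> K"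
    and K': "\<And>t. 0 \<le> t \<Longrightarrow> L2_norm \<Omega> (ddt \<Omega> u t) \<le> K'"
    using solution unfolding damped_wave_solution_def W1inf_in_def by metis
  show thesis
  proof
    fix t :: real assume t: "0 \<le> t"
    show "form (Z t) (Z t) \<le> K'\<^sup>2 + K\<^sup>2"
      unfolding Z_def form_state[OF u_H1[OF t] ut_L2[OF t]]
      using t by (intro add_mono power_mono K K' L2_norm_nonneg H10_norm_nonneg)
  qed
qed

text \<open>With D = Z s - Z t, the energy difference is half of form(D, Z s) + form(D, Z t);
  Cauchy-Schwarz uses that \<open>Z\<close> is Lipschitz for the first factor and bounded for the
  second.\<close>

lemma energy_lipschitz:
  obtains L where "\<And>s t. 0 \<le> s \<Longrightarrow> 0 \<le> t \<Longrightarrow> \<bar>energy_at s - energy_at t\<bar> \<le> L * \<bar>s - t\<bar>"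
proof -
  obtain L where L: "\<And>s t. 0 \<le> s \<Longrightarrow> 0 \<le> t \<Longrightarrow>
      form (\<lambda>x. Z s x - Z t x) (\<lambda>x. Z s x - Z t x) \<le> L * (s - t)\<^sup>2"
    using Z_lipschitz by blast
  obtain K where K: "\<And>t. 0 \<le> t \<Longrightarrow> form (Z t) (Z t) \<le> K" using Z_bounded by blast
  show thesis
  proof
    fix s t :: real assume st: "0 \<le> s" "0 \<le> t"
    define D where "D x = Z s x - Z t x" for x
    have Zst: "Z s \<in> fields" "Z t \<in> fields" using st Z_fields by auto
    then have D: "D \<in> fields" unfolding D_def by (intro fields_diff)
    have DD: "sqrt (form D D) \<le> sqrt L * \<bar>s - t\<bar>"
      using real_sqrt_le_mono[OF L[OF st]] by (simp add: D_def[abs_def] real_sqrt_mult)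
    have one: "\<bar>form D (Z r)\<bar> \<le> sqrt L * \<bar>s - t\<bar> * sqrt K" if "r = s \<or> r = t" for r
    proof -
      have r: "r \<ge> 0" using st that by auto
      have "\<bar>form D (Z r)\<bar> \<le> sqrt (form D D) * sqrt (form (Z r) (Z r))"
        by (intro form_Cauchy_Schwarz D Z_fields r)
      also have "\<dots> \<le> sqrt L * \<bar>s - t\<bar> * sqrt K"
        \<comment> \<open>The sign of \<open>L\<close> is unknown, so nonnegativity of
          \<open>sqrt L * \<bar>s - t\<bar>\<close> is read off from the bound \<open>DD\<close>
          itself.\<close>
        using order_trans[OF real_sqrt_ge_zero[OF form_nonneg] DD] r
        by (intro mult_mono DD real_sqrt_le_mono K) (auto simp: form_nonneg)
      finally show ?thesis .
    qed
    have "form D (Z s) + form D (Z t) = form (Z s) (Z s) - form (Z t) (Z t)"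
      using Zst by (simp add: D_def[abs_def] form_diff_left form_commute[of "Z t" "Z s"])
    then show "\<bar>energy_at s - energy_at t\<bar> \<le> (sqrt L * sqrt K) * \<bar>s - t\<bar>"
      using one[of s] one[of t] by (simp add: energy_at_eq ac_simps)
  qed
qed

lemma nonlinearity_measurable:
  assumes "t \<ge> 0"
  shows "(\<lambda>x. a x * g (ddt \<Omega> u t x) * ddt \<Omega> u t x) \<in> borel_measurable dx"
proof -
  have "a \<in> borel_measurable dx"
    using a by (simp add: Linf_space_def set_borel_measurable_def borel_measurable_restrict_space_iff mult.commute)
  moreover have "g \<in> borel_measurable borel" using g by (rule borel_measurable_continuous_onI)
  ultimately show ?thesis
    using L2_borel_measurable[OF ut_L2[OF assms]]
    by (intro borel_measurable_times measurable_compose[of _ dx borel g]) auto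
qed

lemma dissipation_nonneg: "dissipation t \<ge> 0"
  unfolding dissipation_def LINT_dx
proof (intro integral_nonneg_AE AE_I2)
  fix x assume "x \<in> space dx"
  then have "a x * (ddt \<Omega> u t x * g (ddt \<Omega> u t x)) \<ge> 0"
    by (intro mult_nonneg_nonneg a_nonneg g_sign) simp
  then show "0 \<le> a x * g (ddt \<Omega> u t x) * ddt \<Omega> u t x" by (simp add: ac_simps)
qed

text \<open>Four facts must hold at the same time \<open>t\<close>: H2 regularity for Green's
  formula, differentiability of \<open>u\<close> in \<open>H10\<close> so that the velocity is an
  admissible multiplier, differentiability of the velocity in L2, and the equation.\<close>

lemma energy_difference_quotient:
  "AE t in lebesgue. 0 < t \<longrightarrow>
     (\<lambda>n. (energy_at (t + 1 / Suc n) - energy_at t) * Suc n) \<longlonglongrightarrow> - dissipation t"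
proof -
  obtain L where L: "\<And>s t. 0 \<le> s \<Longrightarrow> 0 \<le> t \<Longrightarrow>
      form (\<lambda>x. Z s x - Z t x) (\<lambda>x. Z s x - Z t x) \<le> L * (s - t)\<^sup>2"
    using Z_lipschitz by blast
  have "AE t in lebesgue. 0 < t \<longrightarrow> u t \<in> H2 \<Omega>"
    using solution unfolding damped_wave_solution_def Linf_in_def by (auto elim: eventually_mono)
  moreover have "AE t in lebesgue. 0 < t \<longrightarrow> has_time_deriv (H10 \<Omega>) (H10_norm M \<Omega>) u (ddt \<Omega> u t) t"
    using solution unfolding damped_wave_solution_def W1inf_in_def by auto
  moreover have "AE t in lebesgue. 0 < t \<longrightarrow>
      has_time_deriv (L2 \<Omega>) (L2_norm \<Omega>) (ddt \<Omega> u) (ddt \<Omega> (ddt \<Omega> u) t) t"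
    using solution unfolding damped_wave_solution_def W1inf_in_def by auto
  moreover have "AE t in lebesgue. 0 < t \<longrightarrow> (AE x in lebesgue. x \<in> \<Omega> \<longrightarrow>
        ddt \<Omega> (ddt \<Omega> u) t x - laplace M \<Omega> (u t) x + a x * g (ddt \<Omega> u t x) = 0)"
    using solution unfolding damped_wave_solution_def by auto
  ultimately show ?thesis
  proof eventually_elim
    case (elim t)
    show ?case
    proof
      assume t: "0 < t"
      define v where "v = ddt \<Omega> u t"
      define w where "w = ddt \<Omega> (ddt \<Omega> u) t"
      have uH2: "u t \<in> H2 \<Omega>"
        and dv: "has_time_deriv (H10 \<Omega>) (H10_norm M \<Omega>) u v t"
        and dw: "has_time_deriv (L2 \<Omega>) (L2_norm \<Omega>) (ddt \<Omega> u) w t"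
        and eqn: "AE x in dx. w x - laplace M \<Omega> (u t) x + a x * g (v x) = 0"
        using elim t by (auto simp: v_def w_def AE_dx)
      have v: "v \<in> H10 \<Omega>" and w: "w \<in> L2 \<Omega>" using dv dw by (auto simp: has_time_deriv_def)
      note v1 = H10_H1[OF v]
      note v2 = H1D(1)[OF v1]
      \<comment> \<open>The candidate derivative of \<open>Z\<close> at \<open>t\<close>: the
        acceleration paired with the gradient of the velocity.\<close>
      have Wf: "state v w \<in> fields" by (intro state_fields v1 w)
      have lim: "(\<lambda>n. (energy_at (t + 1 / Suc n) - energy_at t) / (1 / Suc n)) \<longlonglongrightarrow> form (state v w) (Z t)"
        unfolding energy_at_eq
      proof (rule form_difference_quotient_limit[where L = L])
        show "Z (t + 1 / Suc n) \<in> fields" for n using t by (intro Z_fields) (auto intro!: add_nonneg_nonneg simp del: of_nat_Suc)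
        show "Z t \<in> fields" using t by (intro Z_fields) simp
        show "(\<lambda>n. 1 / real (Suc n)) \<longlonglongrightarrow> 0" using LIMSEQ_Suc[OF lim_1_over_n] by simp
        show "form (\<lambda>x. Z (t + 1 / Suc n) x - Z t x) (\<lambda>x. Z (t + 1 / Suc n) x - Z t x) \<le> L * (1 / Suc n)\<^sup>2" for n
          using L[of "t + 1 / Suc n" t] t by (simp add: add_nonneg_nonneg del: of_nat_Suc)
        show "(\<lambda>n. form (\<lambda>x. (1 / (1 / Suc n)) *\<^sub>R (Z (t + 1 / Suc n) x - Z t x) - state v w x)
            (\<lambda>x. (1 / (1 / Suc n)) *\<^sub>R (Z (t + 1 / Suc n) x - Z t x) - state v w x)) \<longlonglongrightarrow> 0"
        proof -
          \<comment> \<open>Off a null set the pointwise error is the \<open>state\<close> of a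
            combination of functions, obtained by using linearity twice: for the increments
            \<open>V\<close>, \<open>V'\<close>, then for subtracting the derivative. Its form
            splits into the two norms that the time derivatives control.\<close>
          have eq: "form (\<lambda>x. (1 / (1 / Suc n)) *\<^sub>R (Z (t + 1 / Suc n) x - Z t x) - state v w x)
                (\<lambda>x. (1 / (1 / Suc n)) *\<^sub>R (Z (t + 1 / Suc n) x - Z t x) - state v w x)
              = (L2_norm \<Omega> (\<lambda>x. (ddt \<Omega> u (t + 1 / Suc n) x - ddt \<Omega> u t x) * Suc n - w x))\<^sup>2
                + (H10_norm M \<Omega> (\<lambda>x. (u (t + 1 / Suc n) x - u t x) * Suc n - v x))\<^sup>2" for n
          proof -
            define s where "s = t + 1 / Suc n"
            define k where "k = real (Suc n)"
            have s: "s \<ge> 0" unfolding s_def using t by (auto intro!: add_nonneg_nonneg simp del: of_nat_Suc)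
            have t0: "t \<ge> 0" using t by simp
            define V where "V x = 1 * u s x + (-1) * u t x" for x
            define V' where "V' x = 1 * ddt \<Omega> u s x + (-1) * ddt \<Omega> u t x" for x
            have V: "V \<in> H1 \<Omega>" unfolding V_def using s t0 by (intro H1_lincomb u_H1)
            have V': "V' \<in> L2 \<Omega>" unfolding V'_def using s t0 by (intro L2_add L2_cmult ut_L2)
            have V2: "(\<lambda>x. k * V x + (-1) * v x) \<in> H1 \<Omega>" by (intro H1_lincomb V v1)
            have V2': "(\<lambda>x. k * V' x + (-1) * w x) \<in> L2 \<Omega>" by (intro L2_add L2_cmult V' w)
            have "form (\<lambda>x. k *\<^sub>R (Z s x - Z t x) - state v w x) (\<lambda>x. k *\<^sub>R (Z s x - Z t x) - state v w x)
              = form (state (\<lambda>x. k * V x + (-1) * v x) (\<lambda>x. k * V' x + (-1) * w x))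
                  (state (\<lambda>x. k * V x + (-1) * v x) (\<lambda>x. k * V' x + (-1) * w x))"
            proof (rule form_cong_AE)
              show "AE x in dx. k *\<^sub>R (Z s x - Z t x) - state v w x
                  = state (\<lambda>x. k * V x + (-1) * v x) (\<lambda>x. k * V' x + (-1) * w x) x"
                using state_lincomb_AE[OF V v1, of k "-1" V' w]
                  state_lincomb_AE[OF u_H1[OF s] u_H1[OF t0], of 1 "-1" "ddt \<Omega> u s" "ddt \<Omega> u t"]
                unfolding V_def[symmetric] V'_def[symmetric]
                by eventually_elim (simp add: Z_def)
            qed (use V2 V2' Wf s t0 in \<open>auto intro!: fields_diff fields_scale Z_fields state_fields\<close>)
            also have "\<dots> = (L2_norm \<Omega> (\<lambda>x. k * V' x + (-1) * w x))\<^sup>2 + (H10_norm M \<Omega> (\<lambda>x. k * V x + (-1) * v x))\<^sup>2"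
              by (rule form_state[OF V2 V2'])
            finally show ?thesis
              by (simp add: V_def V'_def s_def k_def mult.commute del: of_nat_Suc)
          qed
          have "(\<lambda>n. (L2_norm \<Omega> (\<lambda>x. (ddt \<Omega> u (t + 1 / Suc n) x - ddt \<Omega> u t x) * Suc n - w x))\<^sup>2
                + (H10_norm M \<Omega> (\<lambda>x. (u (t + 1 / Suc n) x - u t x) * Suc n - v x))\<^sup>2) \<longlonglongrightarrow> 0\<^sup>2 + 0\<^sup>2"
            using t by (intro tendsto_add tendsto_power has_time_deriv_sequence[OF dv] has_time_deriv_sequence[OF dw]) auto
          then show ?thesis unfolding eq by simp
        qed
      qed (use Wf in auto)
      have Gr: "laplace M \<Omega> (u t) \<in> L2 \<Omega>"
        "(\<integral>x. snd (state v w x) \<bullet> (M x *v snd (Z t x)) \<partial>dx) = - (\<integral>x. laplace M \<Omega> (u t) x * v x \<partial>dx)"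
        unfolding Z_def using Green_formula[OF uH2 v] by auto
      have iwv: "integrable dx (\<lambda>x. w x * v x)" by (intro L2_mult_integrable w v2)
      \<comment> \<open>Subtracting the velocity product from the full density leaves the gradient
        part, which is therefore integrable.\<close>
      have "integrable dx (\<lambda>x. energy_density x (state v w x) (Z t x))"
        using t by (intro energy_density_integrable Wf Z_fields) simp
      then have "integrable dx (\<lambda>x. energy_density x (state v w x) (Z t x) - w x * v x)"
        using iwv by (rule Bochner_Integration.integrable_diff)
      then have iM: "integrable dx (\<lambda>x. snd (state v w x) \<bullet> (M x *v snd (Z t x)))"
        by (simp add: energy_density_def Z_def state_def v_def)
      have "form (state v w) (Z t) = (\<integral>x. w x * v x + snd (state v w x) \<bullet> (M x *v snd (Z t x)) \<partial>dx)"
        by (simp add: form_def energy_density_def Z_def state_def v_def)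
      also have "\<dots> = (\<integral>x. w x * v x \<partial>dx) - (\<integral>x. laplace M \<Omega> (u t) x * v x \<partial>dx)"
        using iwv iM Gr(2) by simp
      also have "\<dots> = (\<integral>x. (w x - laplace M \<Omega> (u t) x) * v x \<partial>dx)"
        using iwv L2_mult_integrable[OF Gr(1) v2] by (simp add: left_diff_distrib)
      \<comment> \<open>Integrability of the damping term is inherited from the left side through
        the equation.\<close>
      also have "\<dots> = (\<integral>x. - (a x * g (v x) * v x) \<partial>dx)"
      proof (rule integral_cong_AE)
        show "(\<lambda>x. (w x - laplace M \<Omega> (u t) x) * v x) \<in> borel_measurable dx"
          using L2_mult_integrable[OF L2_diff[OF w Gr(1)] v2] by (rule borel_measurable_integrable)
        show "(\<lambda>x. - (a x * g (v x) * v x)) \<in> borel_measurable dx"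
          using nonlinearity_measurable[of t] t by (simp add: v_def)
        show "AE x in dx. (w x - laplace M \<Omega> (u t) x) * v x = - (a x * g (v x) * v x)"
          using eqn
        proof eventually_elim
          case (elim x)
          then have "w x - laplace M \<Omega> (u t) x = - (a x * g (v x))" by linarith
          then show ?case by simp
        qed
      qed
      also have "\<dots> = - dissipation t" by (simp add: dissipation_def LINT_dx v_def)
      finally show "(\<lambda>n. (energy_at (t + 1 / Suc n) - energy_at t) * Suc n) \<longlonglongrightarrow> - dissipation t"
        using lim by simp
    qed
  qed
qed

lemma energy_identity:
  assumes "0 \<le> s" "s \<le> t"
  shows "(LINT \<tau>:{s..t}|lebesgue. dissipation \<tau>) = energy_at s - energy_at t"
proof -
  obtain L where "\<And>s t. 0 \<le> s \<Longrightarrow> 0 \<le> t \<Longrightarrow> \<bar>energy_at s - energy_at t\<bar> \<le> L * \<bar>s - t\<bar>"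
    using energy_lipschitz by blast
  from lipschitz_integral_of_difference_quotient_limit(2)[OF this energy_difference_quotient assms]
  have "(LINT \<tau>:{s..t}|lebesgue. - dissipation \<tau>) = energy_at t - energy_at s" by simp
  then show ?thesis by (simp add: set_lebesgue_integral_def)
qed

lemma energy_antimono:
  assumes "0 \<le> s" "s \<le> t"
  shows "energy_at t \<le> energy_at s"
proof -
  have "0 \<le> (LINT \<tau>:{s..t}|lebesgue. dissipation \<tau>)"
    unfolding set_lebesgue_integral_def
    by (intro integral_nonneg_AE AE_I2) (simp add: dissipation_nonneg)
  then show ?thesis using energy_identity[OF assms] by simp
qed

text \<open>The initial values agree almost everywhere; by \<open>is_weak_deriv_cong_AE\<close> the
  chosen gradients then coincide exactly.\<close>

lemma energy_initial: "energy_at 0 = energy M \<Omega> u0 u1"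
proof -
  have init: "AE x in dx. u 0 x = u0 x" "AE x in dx. ddt \<Omega> u 0 x = u1 x"
    using solution unfolding damped_wave_solution_def AE_dx by (auto elim: eventually_mono)
  have u0': "u0 \<in> H1 \<Omega>" "u1 \<in> L2 \<Omega>"
    using u0 u1 H10_H1 H1D(1) by auto
  have "is_weak_deriv \<Omega> i (u 0) = is_weak_deriv \<Omega> i u0" for i
    using init(1) by (intro is_weak_deriv_cong_AE L2_borel_measurable H1D(1) u_H1 u0') auto
  then have eq: "weak_deriv \<Omega> i (u 0) = weak_deriv \<Omega> i u0" for i by (simp add: weak_deriv_def)
  have "form (Z 0) (Z 0) = form (state u0 u1) (state u0 u1)"
  proof (rule form_cong_AE)
    show "AE x in dx. Z 0 x = state u0 u1 x"
      using init(2) by eventually_elim (simp add: Z_def state_def eq)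
  qed (auto intro!: Z_fields state_fields u0')
  then show ?thesis by (simp add: energy_at_eq energy_eq_form)
qed

end

section \<open>Decay rate for the damped wave equation\<close>

theorem theorem3p3:
  fixes \<Omega> :: "(real^'n) set"
    and M :: "real^'n \<Rightarrow> real^'n^'n"
    and a :: "real^'n \<Rightarrow> real"
    and g :: "real \<Rightarrow> real"
    and r k p c1 c2 c3 c4 :: real
    and \<G> \<F> G :: "real \<Rightarrow> real"
    and c C2 :: real
  assumes dim: "CARD('n) > 1"
    and domain: "open \<Omega>" "connected \<Omega>" "bounded \<Omega>" "C2_boundary \<Omega>"
    and M_smooth: "smooth_on_closure \<Omega> M"
    and M_symmetric: "\<And>x. x \<in> closure \<Omega> \<Longrightarrow> transpose (M x) = M x"
    and M_positive: "\<exists>\<mu>>0. \<forall>x\<in>closure \<Omega>. \<forall>\<xi>. \<mu> * (norm \<xi>)\<^sup>2 \<le> \<xi> \<bullet> (M x *v \<xi>)"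
    and a_bounded: "a \<in> Linf_space \<Omega>"
    and a_nonneg: "\<And>x. x \<in> \<Omega> \<Longrightarrow> a x \<ge> 0"
    and g_cont: "continuous_on UNIV g" and g_mono: "strict_mono g"
    and g_zero: "g 0 = 0" and g_sign: "\<And>s. s * g s \<ge> 0"
    and r: "1 \<le> r" and k: "0 \<le> k" "k \<le> 1" and p: "1 \<le> p"
    and c_pos: "c1 > 0" "c2 > 0" "c3 > 0" "c4 > 0"
    and g_small: "\<And>s. \<bar>s\<bar> \<le> 1 \<Longrightarrow>
          c1 * \<bar>s\<bar> powr r \<le> \<bar>g s\<bar> \<and> \<bar>g s\<bar> \<le> c2 * \<bar>s\<bar> powr (1 / r)"
    and g_large: "\<And>s. \<bar>s\<bar> > 1 \<Longrightarrow>
          c3 * \<bar>s\<bar> powr k \<le> \<bar>g s\<bar> \<and> \<bar>g s\<bar> \<le> c4 * \<bar>s\<bar> powr p"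
    and exponents: "(real CARD('n) - 2) * (1 - k) \<le> 4 * r" "(real CARD('n) - 2) * (p - 1) \<le> 1"
    and \<G>: "continuous_on {0..} \<G>" "strict_mono_on {0..} \<G>" "bij_betw \<G> {0..} {0..}"
    and \<F>: "\<And>x. x \<ge> 0 \<Longrightarrow> \<F> x = x * (\<G> x)\<^sup>2"
    and \<F>_inv_mono: "mono_on {0<..} (\<lambda>x. x * inv_nonneg \<F> (1 / x))"
    and observability: "\<exists>C1>0. \<forall>u0 \<in> H2 \<Omega> \<inter> H10 \<Omega>. \<forall>u1 \<in> H10 \<Omega>. \<not> zero_data \<Omega> u0 u1 \<longrightarrow>
          (\<forall>\<phi>. wave_solution M \<Omega> u0 u1 \<phi> \<longrightarrow>
            (H10_norm M \<Omega> u0)\<^sup>2 + (L2_norm \<Omega> u1)\<^sup>2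
            \<le> C1 * (LINT t:{0..1 / \<G> (1 / (2 * C1 * Lambda_data M \<Omega> a g r k p u0 u1))}|lebesgue.
                      (LINT x:\<Omega>|lebesgue. a x * \<bar>ddt \<Omega> \<phi> t x\<bar>\<^sup>2)))"
    and c: "c > 0" and C2: "C2 > 0"
    and G: "\<And>h. h \<ge> 0 \<Longrightarrow> G h = C2 * h powr (2 * r + 1) * \<F> h powr (4 * (r + 1))"
    and energy_estimate: "\<forall>u0 \<in> H2 \<Omega> \<inter> H10 \<Omega>. \<forall>u1 \<in> H10 \<Omega>. \<forall>h>0. \<forall>s\<ge>0.
          \<forall>u. damped_wave_solution M \<Omega> a g u0 u1 u \<longrightarrow>
            energy M \<Omega> (u s) (ddt \<Omega> u s)
            \<le> c * h * ((r - 1) + X_data M \<Omega> a g r k p u0 u1)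
              + c * (LINT t:{s..s + 1 / G h}|lebesgue.
                      (LINT x:\<Omega>|lebesgue. a x * g (ddt \<Omega> u t x) * ddt \<Omega> u t x))"
    and G_inv: "\<exists>c0>0. \<forall>x\<ge>0. inv_nonneg G x \<ge> c / (c + 1) * inv_nonneg G (x * (c0 + 1))"
  shows "\<exists>c'>0. \<forall>u0 \<in> H2 \<Omega> \<inter> H10 \<Omega>. \<forall>u1 \<in> H10 \<Omega>. \<not> zero_data \<Omega> u0 u1 \<longrightarrow>
          (\<exists>C>0. \<forall>u. damped_wave_solution M \<Omega> a g u0 u1 u \<longrightarrow>
            (\<forall>\<^sub>F t in at_top. energy M \<Omega> (u t) (ddt \<Omega> u t)
              \<le> C * inv_nonneg G (c' / t) * ((r - 1) + X_data M \<Omega> a g r k p u0 u1)))"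
proof (intro exI[of _ "2 * c + 1"] conjI ballI impI allI)
  \<comment> \<open>The same number is the witness for \<open>c'\<close> and for \<open>C\<close>,
    since it occurs in the decay lemma both as factor and inside the inverse.\<close>
  show "2 * c + 1 > 0" "2 * c + 1 > 0" using c by auto
next
  fix u0 u1 u
  assume u0: "u0 \<in> H2 \<Omega> \<inter> H10 \<Omega>" and u1: "u1 \<in> H10 \<Omega>"
    and u: "damped_wave_solution M \<Omega> a g u0 u1 u"
  interpret damped_wave \<Omega> M a g u0 u1 u
    by unfold_locales (use domain M_smooth M_symmetric M_positive a_bounded g_cont a_nonneg g_sign u0 u1 u
        in \<open>simp_all\<close>)
  note G_facts = weight_pos[OF \<G> \<F> C2 r G] weight_strict_mono[OF \<G> \<F> C2 r G]
    weight_surj[OF \<G> \<F> C2 r G] weight_scale[OF \<G> \<F> C2 r G]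
  define D where "D = (r - 1) + X_data M \<Omega> a g r k p u0 u1"
  \<comment> \<open>The other summands of \<open>X_data\<close> and \<open>r - 1\<close> are
    nonnegative, so \<open>D\<close> dominates the initial energy, as the start of the recursion
    requires.\<close>
  have "energy1 M \<Omega> a g u0 u1 \<ge> 0" by (simp add: energy1_def)
  moreover have "x powr y \<ge> 0" for x y :: real by simp
  ultimately have "energy M \<Omega> u0 u1 \<le> X_data M \<Omega> a g r k p u0 u1"
    by (simp add: X_data_def add_nonneg_nonneg add.assoc)
  then have e_0: "energy_at 0 \<le> D"
    using r by (simp add: D_def energy_initial)
  moreover have "energy_at 0 \<ge> 0" by (simp add: energy_at_eq form_nonneg)
  ultimately have D: "D \<ge> 0" by linarith
  have est: "energy_at s \<le> c * h * D + c * (energy_at s - energy_at (s + 1 / G h))"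
    if "h > 0" "s \<ge> 0" for h s
  proof -
    have "energy_at s \<le> c * h * D + c * (LINT \<tau>:{s..s + 1 / G h}|lebesgue. dissipation \<tau>)"
      using energy_estimate u0 u1 u that by (simp add: energy_at_def dissipation_def D_def)
    moreover have "s \<le> s + 1 / G h" using G_facts(1)[of h] that by simp
    ultimately show ?thesis using energy_identity[of s "s + 1 / G h"] that by simp
  qed
  \<comment> \<open>The bound holds at every positive time, where \<open>(2 * c + 1) / t\<close>
    lies in the range of \<open>G\<close>.\<close>
  show "\<forall>\<^sub>F t in at_top. energy M \<Omega> (u t) (ddt \<Omega> u t)
      \<le> (2 * c + 1) * inv_nonneg G ((2 * c + 1) / t) * ((r - 1) + X_data M \<Omega> a g r k p u0 u1)"
    using eventually_gt_at_top[of 0]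
  proof eventually_elim
    case (elim t)
    have "energy_at t \<le> (2 * c + 1) * inv_into {0..} G ((2 * c + 1) / t) * D"
      by (rule decay_from_observation[OF c energy_antimono e_0 D G_facts est elim])
    then show ?case by (simp add: energy_at_def D_def inv_nonneg_def)
  qed
qed

end
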